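(* As identities of power series in $\theta$ (valid for real $\theta$ near $0$), writing $E(\theta)=\sum_{n\ge0}\frac{(-1)^n\theta^{2n+1}}{(2n+1)!}\eta(1-2n)=\frac{\theta}{1!}\eta(1)-\frac{\theta^3}{3!}\eta(-1)+\frac{\theta^5}{5!}\eta(-3)-\cdots$, $$\sum_{n\ge0}\frac{(-1)^n\theta^{2n}}{(2n)!}\mathcal{J}^2(-2n)=\frac12\left(\frac{\pi^2}{12}-\log^2\!\left(2\cos\frac\theta2\right)\right)-\frac12\tan\frac\theta2\left(\theta\log\!\left(2\cos\frac\theta2\right)-E(\theta)\right),$$ $$\sum_{n\ge0}\frac{(-1)^n\theta^{2n+1}}{(2n+1)!}\mathcal{J}^2(-2n-1)=\frac12\tan\frac\theta2\left(\log^2\!\left(2\cos\frac\theta2\right)-\frac{\pi^2}{12}\right)-\frac12\left(\theta\log\!\left(2\cos\frac\theta2\right)-E(\theta)\right).$$ Moreover, for every integer $k\ge0$, $$\mathcal{J}^2(-k)=\mathcal{J}(1-k)-\frac{\eta(2-k)}{2}+\sum_{j=0}^{k-1}\binom{k}{j}\eta(j-k)\left(\eta(2-j)-2\mathcal{J}(1-j)\right).$$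
   Context: $H_n=1+\frac12+\cdots+\frac1n$. $\eta(s)=\sum_{n\ge1}(-1)^{n+1}n^{-s}$ is the Dirichlet eta function (entire). For $m\ge1$, $\mathcal{J}^m(s)=\sum_{n\ge1}(-1)^{n+1}H_n^m n^{-s}$ for $\Re(s)>0$, analytically continued to an entire function; $\mathcal{J}=\mathcal{J}^1$. *)

theory Defs
  imports "HOL-Complex_Analysis.Complex_Analysis"
begin

(* f is entire and equals the (convergent) alternating Dirichlet series
   sum_(n >= 1) (-1)^(n+1) a(n) n^(-s) on the half-plane Re s > 0.
   The summation index is shifted: the summand with index n is the one for n + 1. *)
definition continues_alt_dirichlet :: "(nat \<Rightarrow> complex) \<Rightarrow> (complex \<Rightarrow> complex) \<Rightarrow> bool" where
  "continues_alt_dirichlet a f \<longleftrightarrow>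
     f holomorphic_on UNIV \<and>
     (\<forall>s. Re s > 0 \<longrightarrow>
        (\<lambda>n. (-1) ^ n * a (Suc n) * of_nat (Suc n) powr (- s)) sums f s)"

lemma continues_alt_dirichlet_unique:
  assumes "continues_alt_dirichlet a f" and "continues_alt_dirichlet a g"
  shows "f = g"
proof
  fix s
  have hol: "(\<lambda>z. f z - g z) holomorphic_on UNIV"
    using assms by (auto simp: continues_alt_dirichlet_def intro!: holomorphic_intros)
  have "open {z. Re z > 0}"
    by (rule open_halfspace_Re_gt)
  then have lim: "1 islimpt {z. Re z > 0}"
    by (intro interior_limit_point) (simp add: interior_open)
  have "f z - g z = 0" if "z \<in> {z. Re z > 0}" for z
    using assms that by (auto simp: continues_alt_dirichlet_def intro: sums_unique2)
  then have "f s - g s = 0"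
    by (rule analytic_continuation[OF hol open_UNIV connected_UNIV subset_UNIV UNIV_I lim]) auto
  then show "f s = g s"
    by simp
qed

(* By the lemma above there is at most one such function, so the description is
   proper as soon as the continuation exists. *)
definition alt_dirichlet :: "(nat \<Rightarrow> complex) \<Rightarrow> complex \<Rightarrow> complex" where
  "alt_dirichlet a = (THE f. continues_alt_dirichlet a f)"

definition dirichlet_eta :: "complex \<Rightarrow> complex" where
  "dirichlet_eta = alt_dirichlet (\<lambda>n. 1)"

(* harm n is the n-th harmonic number; the power m acts on harm n, not on the function. *)
definition harmonic_eta :: "nat \<Rightarrow> complex \<Rightarrow> complex" where
  "harmonic_eta m = alt_dirichlet (\<lambda>n. harm n ^ m)"

definition E_term :: "real \<Rightarrow> nat \<Rightarrow> complex" where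
  "E_term \<theta> n = (-1) ^ n * of_real \<theta> ^ (2 * n + 1) / fact (2 * n + 1)
                  * dirichlet_eta (1 - 2 * of_nat n)"

(* Meaningful only where the series converges, which has to be stated separately. *)
definition E_fun :: "real \<Rightarrow> complex" where
  "E_fun \<theta> = (\<Sum>n. E_term \<theta> n)"

end

theory Submission
  imports Defs "HOL-Real_Asymp.Real_Asymp"
begin

text \<open>
  Let \<open>T a s x = \<Sum>(-1)\<^sup>n\<^sup>+\<^sup>1 a(n) n\<^sup>-\<^sup>s e\<^sup>-\<^sup>n\<^sup>x\<close> for \<open>x > 0\<close>. If the iterated differences of \<open>a\<close> decay
  like those of \<open>n\<^sup>\<rho>\<close> for every \<open>\<rho> > 0\<close>, then finitely many steps of the Euler transform turn the
  series into one that converges uniformly for \<open>x \<ge> 0\<close>, locally uniformly in \<open>s\<close>. So the Abel sums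
  \<open>lim T a s x\<close> for \<open>x \<rightarrow> 0\<close> exist for all \<open>s\<close> and form the entire continuation of the Dirichlet
  series. Since \<open>d/dx\<close> maps \<open>T a s\<close> to \<open>-T a (s - 1)\<close>, any holomorphic extension of \<open>T a s\<close> to a
  neighbourhood of \<open>0\<close> has the values of the continuation at \<open>s - k\<close> as its Taylor coefficients, up to
  the factor \<open>(-1)\<^sup>k / k!\<close>.

  With \<open>z = e\<^sup>-\<^sup>x\<close>, \<open>L = ln(1 + z)\<close> and \<open>D = -Li\<^sub>2(-z)\<close> the extensions are \<open>z / (1 + z)\<close>, \<open>L\<close>, \<open>D\<close> for
  \<open>a = 1\<close>, \<open>s = 0, 1, 2\<close>, and \<open>L / (1 + z)\<close>, some \<open>P\<close> for \<open>a = H\<close>, \<open>s = 0, 1\<close>, and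
  \<open>(2P - D) / (1 + z) = (D - L\<^sup>2) / (1 + z)\<close> for \<open>a = H\<^sup>2\<close>, \<open>s = 0\<close>. The Leibniz rule applied to
  \<open>(2P - D) (1 - z / (1 + z))\<close> gives the recurrence. Evaluating \<open>(D - L\<^sup>2) / (1 + z)\<close> at
  \<open>x = \<plusminus>\<i>\<theta>\<close> and using \<open>D(x) + D(-x) = x\<^sup>2 / 2 + \<pi>\<^sup>2 / 6\<close> gives the two generating functions.
\<close>

section \<open>The Euler transform and iterated differences\<close>

text \<open>The sign is opposite to that of the usual forward difference, so that the Euler
  transform has only plus signs.\<close>

definition bdiff :: "(nat \<Rightarrow> 'a::minus) \<Rightarrow> nat \<Rightarrow> 'a" where
  "bdiff f n = f n - f (Suc n)"

text \<open>The value that K steps of the Euler transform assign to the alternating series of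
  \<open>f\<close>: K boundary terms and a remaining series of K-th differences. It is meaningful
  only where that remaining series converges.\<close>

definition euler_sum :: "(nat \<Rightarrow> complex) \<Rightarrow> nat \<Rightarrow> complex" where
  "euler_sum f K = (\<Sum>j<K. (bdiff ^^ j) f 0 / 2 ^ Suc j) + (\<Sum>n. (-1) ^ n * (bdiff ^^ K) f n) / 2 ^ K"

text \<open>Summation by parts: twice a partial sum equals \<open>f 0\<close>, plus the partial sum
  of the differences, minus a boundary term \<open>(-1) ^ N * f N\<close> that tends to 0.\<close>

lemma euler_step:
  fixes f :: "nat \<Rightarrow> complex"
  assumes "f \<longlonglongrightarrow> 0" and "(\<lambda>n. (-1) ^ n * bdiff f n) sums S"
  shows "(\<lambda>n. (-1) ^ n * f n) sums ((f 0 + S) / 2)"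
proof -
  have part: "(\<Sum>n<N. (-1) ^ n * f n) =
      f 0 / 2 + (\<Sum>n<N. (-1) ^ n * bdiff f n) / 2 - (-1) ^ N * f N / 2" for N
  proof (induction N)
    case (Suc N)
    show ?case
      unfolding sum.lessThan_Suc Suc.IH by (simp add: bdiff_def field_simps)
  qed simp
  have "(\<lambda>N. norm ((-1) ^ N * f N)) \<longlonglongrightarrow> 0"
    using tendsto_norm_zero[OF assms(1)] by (simp add: norm_mult norm_power)
  then have "(\<lambda>N. (-1) ^ N * f N) \<longlonglongrightarrow> 0"
    by (rule tendsto_norm_zero_cancel)
  then have "(\<lambda>N. f 0 / 2 + (\<Sum>n<N. (-1) ^ n * bdiff f n) / 2 - (-1) ^ N * f N / 2)
      \<longlonglongrightarrow> f 0 / 2 + S / 2 - 0 / 2"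
    using assms(2) unfolding sums_def by (intro tendsto_intros) auto
  then show ?thesis
    unfolding sums_def part by (simp add: add_divide_distrib)
qed

text \<open>Convergence is pulled back from the K-th differences through K applications of
  \<open>euler_step\<close>; the original series may converge only conditionally.\<close>

lemma euler_sums:
  assumes "\<And>j. j < K \<Longrightarrow> (bdiff ^^ j) f \<longlonglongrightarrow> 0"
    and "summable (\<lambda>n. (-1) ^ n * (bdiff ^^ K) f n)"
  shows "(\<lambda>n. (-1) ^ n * f n) sums euler_sum f K"
  using assms
proof (induction K arbitrary: f)
  case 0
  then show ?case by (simp add: euler_sum_def summable_sums)
next
  case (Suc K)
  have "(\<lambda>n. (-1) ^ n * bdiff f n) sums euler_sum (bdiff f) K"
    using Suc.prems(1)[of "Suc _"] Suc.prems(2) by (intro Suc.IH) (simp_all add: funpow_swap1)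
  with Suc.prems(1)[of 0]
  have "(\<lambda>n. (-1) ^ n * f n) sums ((f 0 + euler_sum (bdiff f) K) / 2)"
    by (intro euler_step) auto
  also have "(f 0 + euler_sum (bdiff f) K) / 2 = euler_sum f (Suc K)"
    unfolding euler_sum_def sum.lessThan_Suc_shift
    by (simp add: funpow_swap1 sum_divide_distrib add_divide_distrib mult.commute)
  finally show ?case .
qed

text \<open>A discrete analogue of the symbol classes of order \<rho>: every difference gains one
  power of decay. The constants depend on the number of differences but are uniform over
  \<open>I\<close>, which later carries the parameters s and x.\<close>

definition symbol :: "real \<Rightarrow> 'i set \<Rightarrow> ('i \<Rightarrow> nat \<Rightarrow> complex) \<Rightarrow> bool" where
  "symbol \<rho> I F \<longleftrightarrow>
     (\<forall>k. \<exists>C. \<forall>i\<in>I. \<forall>n. norm ((bdiff ^^ k) (F i) n) \<le> C * real (Suc n) powr (\<rho> - real k))"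

lemma symbolE:
  assumes "symbol \<rho> I F"
  obtains C where "C \<ge> 0"
    "\<And>i n. i \<in> I \<Longrightarrow> norm ((bdiff ^^ k) (F i) n) \<le> C * real (Suc n) powr (\<rho> - real k)"
proof -
  obtain C where C: "\<And>i n. i \<in> I \<Longrightarrow>
      norm ((bdiff ^^ k) (F i) n) \<le> C * real (Suc n) powr (\<rho> - real k)"
    using assms unfolding symbol_def by blast
  have "norm ((bdiff ^^ k) (F i) n) \<le> max C 0 * real (Suc n) powr (\<rho> - real k)" if "i \<in> I" for i n
    using C[OF that, of n] by (rule order.trans) (intro mult_right_mono, auto)
  then show ?thesis by (intro that[of "max C 0"]) auto
qed

lemma symbol_bdiff:
  assumes "symbol \<rho> I F"
  shows "symbol (\<rho> - 1) I (\<lambda>i. bdiff (F i))"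
  unfolding symbol_def
proof
  fix k
  have "\<exists>C. \<forall>i\<in>I. \<forall>n. norm ((bdiff ^^ Suc k) (F i) n) \<le> C * real (Suc n) powr (\<rho> - real (Suc k))"
    using assms unfolding symbol_def by blast
  then show "\<exists>C. \<forall>i\<in>I. \<forall>n. norm ((bdiff ^^ k) (bdiff (F i)) n)
      \<le> C * real (Suc n) powr (\<rho> - 1 - real k)"
    by (simp add: funpow_swap1 algebra_simps)
qed

text \<open>The differences control everything except the size of the sequence itself, which
  therefore enters as a separate bound.\<close>

lemma symbol_of_bdiff:
  assumes "symbol (\<rho> - 1) I (\<lambda>i. bdiff (F i))"
    and "\<And>i n. i \<in> I \<Longrightarrow> norm (F i n) \<le> C * real (Suc n) powr \<rho>"
  shows "symbol \<rho> I F"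
  unfolding symbol_def
proof
  fix k
  show "\<exists>C. \<forall>i\<in>I. \<forall>n. norm ((bdiff ^^ k) (F i) n) \<le> C * real (Suc n) powr (\<rho> - real k)"
  proof (cases k)
    case 0
    with assms(2) show ?thesis by auto
  next
    case (Suc l)
    have "\<exists>C. \<forall>i\<in>I. \<forall>n. norm ((bdiff ^^ l) (bdiff (F i)) n)
      \<le> C * real (Suc n) powr (\<rho> - 1 - real l)"
      using assms(1) unfolding symbol_def by blast
    then show ?thesis by (simp add: Suc funpow_swap1 algebra_simps)
  qed
qed

lemma funpow_bdiff_Suc: "(bdiff ^^ Suc k) f n = (bdiff ^^ k) f n - (bdiff ^^ k) f (Suc n)"
  by (simp add: bdiff_def)

lemma funpow_bdiff_shift: "(bdiff ^^ k) (\<lambda>n. f (Suc n)) n = (bdiff ^^ k) f (Suc n)"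
  by (induction k arbitrary: n) (simp_all add: bdiff_def)

lemma funpow_bdiff_add:
  fixes f g :: "nat \<Rightarrow> 'a::ab_group_add"
  shows "(bdiff ^^ k) (\<lambda>n. f n + g n) n = (bdiff ^^ k) f n + (bdiff ^^ k) g n"
  by (induction k arbitrary: n) (simp_all add: bdiff_def)

lemma funpow_bdiff_uminus:
  fixes f :: "nat \<Rightarrow> 'a::ab_group_add"
  shows "(bdiff ^^ k) (\<lambda>n. - f n) n = - (bdiff ^^ k) f n"
  by (induction k arbitrary: n) (simp_all add: bdiff_def)

text \<open>The ratio u / t lies between 1 and c, so its p-th power is at most
  \<open>c powr \<bar>p\<bar>\<close> for either sign of p. This exchanges comparable points in
  power bounds.\<close>

lemma powr_le_powr_abs:
  fixes t u c p :: real
  assumes "t \<ge> 1" "t \<le> u" "u \<le> c * t"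
  shows "u powr p \<le> c powr \<bar>p\<bar> * t powr p"
proof -
  have "1 \<le> u / t" "u / t \<le> c"
    using assms by (simp_all add: field_simps)
  then have "(u / t) powr p \<le> c powr \<bar>p\<bar>"
    by (intro order.trans[OF powr_mono[of p "\<bar>p\<bar>"] powr_mono2]) auto
  then show ?thesis
    using assms by (simp add: powr_divide field_simps)
qed

text \<open>The ratio of n + 2 to n + 1 is at most 2, so only the constants change. The shift is
  needed because the Leibniz rule for differences shifts one factor.\<close>

lemma symbol_shift:
  assumes "symbol \<rho> I F"
  shows "symbol \<rho> I (\<lambda>i n. F i (Suc n))"
  unfolding symbol_def
proof
  fix k
  obtain C where C: "C \<ge> 0"
    "\<And>i n. i \<in> I \<Longrightarrow> norm ((bdiff ^^ k) (F i) n) \<le> C * real (Suc n) powr (\<rho> - real k)"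
    using symbolE[OF assms] by metis
  show "\<exists>C. \<forall>i\<in>I. \<forall>n. norm ((bdiff ^^ k) (\<lambda>n. F i (Suc n)) n) \<le> C * real (Suc n) powr (\<rho> - real k)"
  proof (intro exI ballI allI)
    fix i n assume i: "i \<in> I"
    have "norm ((bdiff ^^ k) (\<lambda>n. F i (Suc n)) n) \<le> C * real (Suc (Suc n)) powr (\<rho> - real k)"
      unfolding funpow_bdiff_shift by (rule C(2)[OF i])
    also have "\<dots> \<le> C * (2 powr \<bar>\<rho> - real k\<bar> * real (Suc n) powr (\<rho> - real k))"
      by (intro mult_left_mono powr_le_powr_abs C) auto
    finally show "norm ((bdiff ^^ k) (\<lambda>n. F i (Suc n)) n)
        \<le> (C * 2 powr \<bar>\<rho> - real k\<bar>) * real (Suc n) powr (\<rho> - real k)"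
      by (simp add: mult.assoc)
  qed
qed

text \<open>Induction on the number of differences with the discrete Leibniz rule: the difference of
  FG is the difference of F times G plus the shifted F times the difference of G. Orders and
  families vary in the induction, since each summand has a new pair.\<close>

lemma symbol_mult:
  assumes "symbol \<rho> I F" "symbol \<tau> I G"
  shows "symbol (\<rho> + \<tau>) I (\<lambda>i n. F i n * G i n)"
proof -
  have "\<exists>C. \<forall>i\<in>I. \<forall>n. norm ((bdiff ^^ k) (\<lambda>n. F i n * G i n) n)
      \<le> C * real (Suc n) powr (\<rho> + \<tau> - real k)" for k
    using assms
  proof (induction k arbitrary: \<rho> \<tau> F G)
    case 0
    obtain C where C: "C \<ge> 0" "\<And>i n. i \<in> I \<Longrightarrow> norm (F i n) \<le> C * real (Suc n) powr \<rho>"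
      using symbolE[OF 0(1), of 0] by auto
    obtain D where D: "D \<ge> 0" "\<And>i n. i \<in> I \<Longrightarrow> norm (G i n) \<le> D * real (Suc n) powr \<tau>"
      using symbolE[OF 0(2), of 0] by auto
    have "norm (F i n * G i n) \<le> (C * D) * real (Suc n) powr (\<rho> + \<tau>)" if "i \<in> I" for i n
    proof -
      have "norm (F i n * G i n) \<le> (C * real (Suc n) powr \<rho>) * (D * real (Suc n) powr \<tau>)"
        unfolding norm_mult using C D that by (intro mult_mono) auto
      then show ?thesis by (simp add: powr_add mult_ac)
    qed
    then show ?case by auto
  next
    case (Suc k)
    have eq: "bdiff (\<lambda>n. F i n * G i n) = (\<lambda>n. bdiff (F i) n * G i n + F i (Suc n) * bdiff (G i) n)" for i
      by (simp add: fun_eq_iff bdiff_def algebra_simps)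
    obtain C where C: "\<And>i n. i \<in> I \<Longrightarrow> norm ((bdiff ^^ k) (\<lambda>n. bdiff (F i) n * G i n) n)
      \<le> C * real (Suc n) powr (\<rho> - 1 + \<tau> - real k)"
      using Suc.IH[OF symbol_bdiff[OF Suc.prems(1)] Suc.prems(2)] by metis
    obtain D where D: "\<And>i n. i \<in> I \<Longrightarrow> norm ((bdiff ^^ k) (\<lambda>n. F i (Suc n) * bdiff (G i) n) n)
      \<le> D * real (Suc n) powr (\<rho> + (\<tau> - 1) - real k)"
      using Suc.IH[OF symbol_shift[OF Suc.prems(1)] symbol_bdiff[OF Suc.prems(2)]] by metis
    have exps: "\<rho> - 1 + \<tau> - real k = \<rho> + \<tau> - real (Suc k)" "\<rho> + (\<tau> - 1) - real k = \<rho> + \<tau> - real (Suc k)"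
      by simp_all
    have "norm ((bdiff ^^ Suc k) (\<lambda>n. F i n * G i n) n) \<le> (C + D) * real (Suc n) powr (\<rho> + \<tau> - real (Suc k))"
      if "i \<in> I" for i n
      unfolding funpow_Suc_right o_def eq funpow_bdiff_add
      using norm_triangle_le[OF add_mono[OF C[OF that, of n] D[OF that, of n]]]
      unfolding exps by (simp add: algebra_simps)
    then show ?case by blast
  qed
  then show ?thesis unfolding symbol_def by blast
qed

lemma symbol_mono:
  assumes "symbol \<rho> I F" "\<rho> \<le> \<tau>"
  shows "symbol \<tau> I F"
  unfolding symbol_def
proof
  fix k
  obtain C where C: "C \<ge> 0"
    "\<And>i n. i \<in> I \<Longrightarrow> norm ((bdiff ^^ k) (F i) n) \<le> C * real (Suc n) powr (\<rho> - real k)"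
    using symbolE[OF assms(1)] by metis
  have "norm ((bdiff ^^ k) (F i) n) \<le> C * real (Suc n) powr (\<tau> - real k)" if "i \<in> I" for i n
    using assms(2) by (intro order.trans[OF C(2)[OF that]] mult_left_mono powr_mono C(1)) auto
  then show "\<exists>C. \<forall>i\<in>I. \<forall>n. norm ((bdiff ^^ k) (F i) n) \<le> C * real (Suc n) powr (\<tau> - real k)"
    by blast
qed

lemma symbol_reindex: "symbol \<rho> I F \<Longrightarrow> g ` J \<subseteq> I \<Longrightarrow> symbol \<rho> J (\<lambda>j. F (g j))"
  unfolding symbol_def by (meson image_subset_iff)

text \<open>The k-th difference multiplies the exponential by \<open>(1 - exp (- x)) ^ k\<close>,
  which is at most \<open>x ^ k\<close>. With y = (n + 1) x, the bound
  \<open>exp (- y) * y ^ k \<le> fact k\<close> gives constants uniform down to x = 0.\<close>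

lemma symbol_exp: "symbol 0 {0..} (\<lambda>x n. of_real (exp (- (real (Suc n) * x))))"
proof -
  have diff: "(bdiff ^^ k) (\<lambda>n. complex_of_real (exp (- (real (Suc n) * x)))) n =
      of_real (exp (- (real (Suc n) * x)) * (1 - exp (- x)) ^ k)" for k n x
  proof (induction k arbitrary: n)
    case (Suc k)
    have "exp (- (real (Suc (Suc n)) * x)) = exp (- (real (Suc n) * x)) * exp (- x)"
      by (simp add: algebra_simps flip: exp_add)
    then show ?case
      unfolding funpow_bdiff_Suc Suc.IH by (simp add: algebra_simps)
  qed simp
  have bound: "\<bar>exp (- (real (Suc n) * x)) * (1 - exp (- x)) ^ k\<bar> \<le> fact k * real (Suc n) powr (0 - real k)"
    if "x \<ge> 0" for x :: real and n k
  proof -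
    define y where "y = real (Suc n) * x"
    have "0 \<le> y" using that by (simp add: y_def)
    \<comment> \<open>A single term of the exponential series is at most its sum.\<close>
    have "y ^ k / fact k \<le> exp y"
      using sums_le[OF _ sums_single[of k "\<lambda>k. y ^ k / fact k"], of "\<lambda>k. y ^ k / fact k" "exp y"] \<open>0 \<le> y\<close>
        exp_converges[of y] by (auto simp: field_simps)
    then have *: "exp (- y) * y ^ k \<le> fact k"
      by (simp add: exp_minus field_simps)
    have "0 \<le> 1 - exp (- x)" "1 - exp (- x) \<le> x"
      using that exp_ge_add_one_self[of "-x"] by auto
    then have "\<bar>exp (- y) * (1 - exp (- x)) ^ k\<bar> \<le> exp (- y) * x ^ k"
      by (simp add: abs_mult power_mono)
    also have "x ^ k = y ^ k / real (Suc n) ^ k"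
      by (simp add: y_def power_mult_distrib)
    also have "exp (- y) * \<dots> \<le> fact k / real (Suc n) ^ k"
      using * by (simp add: divide_right_mono)
    also have "\<dots> = fact k * real (Suc n) powr (0 - real k)"
      by (simp add: powr_minus powr_realpow divide_inverse)
    finally show ?thesis by (simp only: y_def)
  qed
  show ?thesis
    unfolding symbol_def diff norm_of_real using bound by auto
qed

section \<open>Analytic continuation by Abel summation\<close>

text \<open>Iterated mean value inequality: a k-th difference is bounded by the k-th derivative on
  an interval of length k. The sequence \<phi> lists a function together with all its
  derivatives.\<close>

lemma funpow_bdiff_le:
  fixes \<phi> :: "nat \<Rightarrow> real \<Rightarrow> complex"
  assumes "\<And>j u. u > 0 \<Longrightarrow> (\<phi> j has_vector_derivative \<phi> (Suc j) u) (at u)"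
    and "\<And>u. u \<in> {1 + real n..1 + real n + real k} \<Longrightarrow> norm (\<phi> k u) \<le> B"
  shows "norm ((bdiff ^^ k) (\<lambda>n. \<phi> 0 (1 + real n)) n) \<le> B"
  using assms
proof (induction k arbitrary: \<phi>)
  case 0
  then show ?case by simp
next
  case (Suc k)
  \<comment> \<open>Unit differences commute with differentiation, so \<open>\<psi>\<close> is again
    a chain of derivatives; the mean value inequality bounds its k-th member by the next derivative
    of \<open>\<phi>\<close>.\<close>
  define \<psi> where "\<psi> j u = \<phi> j u - \<phi> j (u + 1)" for j u
  have "(\<psi> j has_vector_derivative \<psi> (Suc j) u) (at u)" if "u > 0" for j u
  proof -
    have "((\<lambda>u. u + 1) has_vector_derivative 1) (at u)"
      by (auto intro!: derivative_eq_intros)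
    from vector_diff_chain_at[OF this Suc.prems(1)[of "u + 1" j]] that
    have "((\<lambda>u. \<phi> j (u + 1)) has_vector_derivative \<phi> (Suc j) (u + 1)) (at u)"
      by (simp add: o_def)
    then show ?thesis
      unfolding \<psi>_def using Suc.prems(1)[OF that] by (intro has_vector_derivative_diff) auto
  qed
  moreover have "norm (\<psi> k u) \<le> B" if u: "u \<in> {1 + real n..1 + real n + real k}" for u
  proof -
    have "norm (\<phi> k u - \<phi> k (u + 1)) \<le> B * norm (u - (u + 1))"
    proof (rule differentiable_bound[where S = "{u..u + 1}"])
      fix v assume v: "v \<in> {u..u + 1}"
      then have "v > 0" using u by auto
      show "(\<phi> k has_derivative (\<lambda>h. h *\<^sub>R \<phi> (Suc k) v)) (at v within {u..u + 1})"
        using has_vector_derivative_at_within[OF Suc.prems(1)[OF \<open>v > 0\<close>]]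
        by (simp add: has_vector_derivative_def)
      have "norm (\<phi> (Suc k) v) \<le> B"
        using u v by (intro Suc.prems(2)) auto
      then show "onorm (\<lambda>h. h *\<^sub>R \<phi> (Suc k) v) \<le> B"
        by (intro onorm_le) (auto simp: mult.commute[of B] intro!: mult_left_mono)
    qed auto
    then show ?thesis by (simp add: \<psi>_def)
  qed
  ultimately have "norm ((bdiff ^^ k) (\<lambda>n. \<psi> 0 (1 + real n)) n) \<le> B"
    by (rule Suc.IH)
  moreover have "(\<lambda>n. \<psi> 0 (1 + real n)) = bdiff (\<lambda>n. \<phi> 0 (1 + real n))"
    by (simp add: fun_eq_iff \<psi>_def bdiff_def add_ac)
  ultimately show ?case by (simp add: funpow_swap1)
qed

text \<open>The k-th derivative of u powr (-s) is a product of k factors of norm at most R + k,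
  times u powr (-s - k). On the interval in question u lies between n + 1 and (1 + k)(n + 1), which
  gives the second factor of the constant.\<close>

lemma symbol_powr:
  "symbol (- \<sigma>) {s. norm s \<le> R \<and> Re s \<ge> \<sigma>} (\<lambda>s n. of_nat (Suc n) powr (- s))"
  unfolding symbol_def
proof
  fix k
  let ?C = "(R + real k) ^ k * (1 + real k) powr \<bar>- \<sigma> - real k\<bar>"
  have "norm ((bdiff ^^ k) (\<lambda>n. of_nat (Suc n) powr (- s)) n) \<le> ?C * real (Suc n) powr (- \<sigma> - real k)"
    if s: "norm s \<le> R" "Re s \<ge> \<sigma>" for s :: complex and n
  proof -
    define \<phi> where "\<phi> j u = (\<Prod>i<j. - s - of_nat i) * of_real u powr (- s - of_nat j)" for j and u :: real
    have deriv: "(\<phi> j has_vector_derivative \<phi> (Suc j) u) (at u)" if "u > 0" for j u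
    proof -
      have "((\<lambda>z. (\<Prod>i<j. - s - of_nat i) * z powr (- s - of_nat j)) has_field_derivative
          (\<Prod>i<j. - s - of_nat i) * ((- s - of_nat j) * of_real u powr (- s - of_nat j - 1))) (at (of_real u))"
        using that by (intro DERIV_cmult has_field_derivative_powr) auto
      from has_vector_derivative_real_field[OF this] show ?thesis
        by (simp add: \<phi>_def[abs_def] algebra_simps)
    qed
    have bound: "norm (\<phi> k u) \<le> ?C * real (Suc n) powr (- \<sigma> - real k)"
      if u: "u \<in> {1 + real n..1 + real n + real k}" for u
    proof -
      have "norm (\<Prod>i<k. - s - of_nat i) \<le> (\<Prod>i<k. R + real k)"
        unfolding prod_norm[symmetric]
      proof (intro prod_mono conjI norm_ge_zero)
        fix i assume "i \<in> {..<k}"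
        then show "norm (- s - of_nat i) \<le> R + real k"
          using norm_triangle_ineq4[of "- s" "of_nat i"] s by simp
      qed
      moreover have "norm (of_real u powr (- s - of_nat k)) \<le>
          (1 + real k) powr \<bar>- \<sigma> - real k\<bar> * real (Suc n) powr (- \<sigma> - real k)"
      proof -
        have "norm (of_real u powr (- s - of_nat k)) = u powr (- Re s - real k)"
          using u by (subst norm_powr_real_powr) auto
        also have "\<dots> \<le> u powr (- \<sigma> - real k)"
          using s u by (intro powr_mono) auto
        also have "\<dots> \<le> (1 + real k) powr \<bar>- \<sigma> - real k\<bar> * real (Suc n) powr (- \<sigma> - real k)"
          using u by (intro powr_le_powr_abs) (auto simp: algebra_simps intro: order.trans)
        finally show ?thesis .
      qed
      ultimately have "norm (\<phi> k u) \<le> (R + real k) ^ k *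
          ((1 + real k) powr \<bar>- \<sigma> - real k\<bar> * real (Suc n) powr (- \<sigma> - real k))"
        unfolding \<phi>_def norm_mult using order.trans[OF norm_ge_zero s(1)]
        by (intro mult_mono) (auto intro: order.trans[OF norm_ge_zero])
      then show ?thesis by (simp add: mult.assoc)
    qed
    have "norm ((bdiff ^^ k) (\<lambda>n. \<phi> 0 (1 + real n)) n) \<le> ?C * real (Suc n) powr (- \<sigma> - real k)"
      by (rule funpow_bdiff_le[OF deriv bound])
    moreover have "(\<lambda>n. \<phi> 0 (1 + real n)) = (\<lambda>n. of_nat (Suc n) powr (- s))"
      by (simp add: \<phi>_def)
    ultimately show ?thesis by simp
  qed
  then show "\<exists>C. \<forall>s\<in>{s. norm s \<le> R \<and> Re s \<ge> \<sigma>}. \<forall>n.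
      norm ((bdiff ^^ k) (\<lambda>n. of_nat (Suc n) powr (- s)) n) \<le> C * real (Suc n) powr (- \<sigma> - real k)"
    by blast
qed

text \<open>Requiring all positive orders admits logarithmic growth and makes the class closed under
  products, by splitting \<rho> into two halves. The one-element index set specialises the notion
  for families to a single sequence.\<close>

definition slow :: "(nat \<Rightarrow> complex) \<Rightarrow> bool" where
  "slow a \<longleftrightarrow> (\<forall>\<rho>>0. symbol \<rho> (UNIV :: unit set) (\<lambda>_ n. a (Suc n)))"

lemma slow_one: "slow (\<lambda>_. 1)"
  unfolding slow_def
proof (intro allI impI)
  fix \<rho> :: real assume "\<rho> > 0"
  have "symbol (0 - 1) (UNIV :: unit set) (\<lambda>_. bdiff (\<lambda>_. 1))"
  proof -
    have "(bdiff ^^ k) (bdiff (\<lambda>_. 1)) n = (0 :: complex)" for k n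
      by (induction k arbitrary: n) (simp_all add: bdiff_def)
    then show ?thesis unfolding symbol_def by (auto intro!: exI[of _ 0])
  qed
  then have "symbol 0 (UNIV :: unit set) (\<lambda>_ _. 1)"
    by (rule symbol_of_bdiff[where C = 1]) auto
  then show "symbol \<rho> (UNIV :: unit set) (\<lambda>_ _. 1)"
    using \<open>\<rho> > 0\<close> by (auto elim: symbol_mono)
qed

lemma slow_mult:
  assumes "slow a" "slow b"
  shows "slow (\<lambda>n. a n * b n)"
  unfolding slow_def
proof (intro allI impI)
  fix \<rho> :: real assume "\<rho> > 0"
  then have "symbol (\<rho> / 2 + \<rho> / 2) (UNIV :: unit set) (\<lambda>_ n. a (Suc n) * b (Suc n))"
    using assms unfolding slow_def by (intro symbol_mult) auto
  then show "symbol \<rho> (UNIV :: unit set) (\<lambda>_ n. a (Suc n) * b (Suc n))"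
    by simp
qed

lemma slow_power: "slow a \<Longrightarrow> slow (\<lambda>n. a n ^ m)"
  by (induction m) (auto intro: slow_one slow_mult)

lemma symbol_uminus:
  assumes "symbol \<rho> I F"
  shows "symbol \<rho> I (\<lambda>i n. - F i n)"
  using assms unfolding symbol_def funpow_bdiff_uminus by simp

lemma harm_Suc_le: "harm (Suc n) \<le> 1 + ln (real (Suc n))"
proof (induction n)
  case (Suc n)
  have "ln (real (Suc n) / real (Suc (Suc n))) \<le> real (Suc n) / real (Suc (Suc n)) - 1"
    by (intro ln_le_minus_one) auto
  then have "inverse (real (Suc (Suc n))) \<le> ln (real (Suc (Suc n))) - ln (real (Suc n))"
    by (simp add: ln_div field_simps)
  with Suc show ?case by (simp add: harm_Suc)
qed (simp add: harm_def)

text \<open>The difference of consecutive harmonic numbers is -1/(n + 2), a shifted power of order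
  -1; their size is at most 1 + ln (n + 1), which is below any positive power up to a
  constant.\<close>

lemma slow_harm: "slow harm"
  unfolding slow_def
proof (intro allI impI)
  fix \<rho> :: real assume "\<rho> > 0"
  have "symbol (- 1) (UNIV :: unit set) (\<lambda>_ n. of_nat (Suc n) powr (- 1))"
    by (rule symbol_reindex[OF symbol_powr[of 1 1], of "\<lambda>_. 1"]) auto
  then have "symbol (- 1) (UNIV :: unit set) (\<lambda>_ n. - (of_nat (Suc (Suc n)) powr (- 1)))"
    by (rule symbol_uminus[OF symbol_shift])
  also have "(\<lambda>_ n. - (of_nat (Suc (Suc n)) powr (- 1))) = (\<lambda>(_::unit). bdiff (\<lambda>n. harm (Suc n) :: complex))"
    by (simp add: fun_eq_iff bdiff_def harm_Suc powr_minus)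
  finally have "symbol (\<rho> - 1) (UNIV :: unit set) (\<lambda>_. bdiff (\<lambda>n. harm (Suc n) :: complex))"
    using \<open>\<rho> > 0\<close> by (auto elim: symbol_mono)
  then show "symbol \<rho> (UNIV :: unit set) (\<lambda>_ n. harm (Suc n))"
  proof (rule symbol_of_bdiff)
    fix n
    have "norm (harm (Suc n) :: complex) = harm (Suc n)"
      by (simp add: norm_harm)
    also have "\<dots> \<le> 1 + ln (real (Suc n))"
      by (rule harm_Suc_le)
    also have "\<dots> \<le> real (Suc n) powr \<rho> + real (Suc n) powr \<rho> / \<rho>"
      using \<open>\<rho> > 0\<close> by (intro add_mono ln_powr_bound ge_one_powr_ge_zero) auto
    also have "\<dots> = (1 + 1 / \<rho>) * real (Suc n) powr \<rho>"
      by (simp add: algebra_simps)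
    finally show "norm (harm (Suc n) :: complex) \<le> (1 + 1 / \<rho>) * real (Suc n) powr \<rho>" .
  qed
qed

section \<open>The exponentially damped series and its limit as the damping vanishes\<close>

definition abel_term :: "(nat \<Rightarrow> complex) \<Rightarrow> complex \<Rightarrow> real \<Rightarrow> nat \<Rightarrow> complex" where
  "abel_term a s x n = a (Suc n) * of_nat (Suc n) powr (- s) * of_real (exp (- (real (Suc n) * x)))"

text \<open>The term is a product of symbols of orders \<rho>, -\<sigma> and 0. Uniformity in s
  serves holomorphy; uniformity in x serves the limit at 0.\<close>

lemma abel_term_bound:
  assumes "slow a" "\<rho> > 0"
  obtains C where "C \<ge> 0" "\<And>s x n. norm s \<le> R \<Longrightarrow> Re s \<ge> \<sigma> \<Longrightarrow> x \<ge> 0 \<Longrightarrow>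
    norm ((bdiff ^^ k) (abel_term a s x) n) \<le> C * real (Suc n) powr (\<rho> - \<sigma> - real k)"
proof -
  let ?I = "{s :: complex. norm s \<le> R \<and> Re s \<ge> \<sigma>} \<times> {0 :: real..}"
  have "symbol \<rho> ?I (\<lambda>_ n. a (Suc n))"
    using assms unfolding slow_def by (auto intro: symbol_reindex[where g = "\<lambda>_. ()"])
  moreover have "symbol (- \<sigma>) ?I (\<lambda>i n. of_nat (Suc n) powr (- fst i))"
    by (rule symbol_reindex[OF symbol_powr[of \<sigma> R]]) auto
  moreover have "symbol 0 ?I (\<lambda>i n. of_real (exp (- (real (Suc n) * snd i))))"
    by (rule symbol_reindex[OF symbol_exp]) auto
  ultimately have "symbol (\<rho> + - \<sigma> + 0) ?I (\<lambda>i n. a (Suc n) * of_nat (Suc n) powr (- fst i) *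
      of_real (exp (- (real (Suc n) * snd i))))"
    by (intro symbol_mult)
  then have "symbol (\<rho> - \<sigma>) ?I (\<lambda>i. abel_term a (fst i) (snd i))"
    by (simp add: abel_term_def[abs_def])
  then obtain C where C: "C \<ge> 0"
    "\<And>i n. i \<in> ?I \<Longrightarrow> norm ((bdiff ^^ k) (abel_term a (fst i) (snd i)) n) \<le> C * real (Suc n) powr (\<rho> - \<sigma> - real k)"
    by (rule symbolE[where k = k]) (rule that)
  show ?thesis
    by (rule that[OF C(1)]) (use C(2)[of "(_, _)"] in auto)
qed

text \<open>Taking \<rho> = 1, the condition K \<ge> 3 - \<sigma> pushes the exponent 1 - \<sigma> -
  K down to at most -2.\<close>

lemma abel_term_bound_summable:
  assumes "slow a" "real K \<ge> 3 - \<sigma>"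
  obtains M where "summable M" "\<And>s x n. norm s \<le> R \<Longrightarrow> Re s \<ge> \<sigma> \<Longrightarrow> x \<ge> 0 \<Longrightarrow>
    norm ((-1) ^ n * (bdiff ^^ K) (abel_term a s x) n) \<le> M n"
proof -
  obtain C where C: "C \<ge> 0" "\<And>s x n. norm s \<le> R \<Longrightarrow> Re s \<ge> \<sigma> \<Longrightarrow> x \<ge> 0 \<Longrightarrow>
    norm ((bdiff ^^ K) (abel_term a s x) n) \<le> C * real (Suc n) powr (1 - \<sigma> - real K)"
    by (rule abel_term_bound[OF assms(1), of 1 R \<sigma> K]) auto
  have "summable (\<lambda>n. C * real (Suc n) powr (- 2))"
    using summable_Suc_iff[of "\<lambda>n. real n powr (- 2)"] by (intro summable_mult) (simp add: summable_real_powr_iff)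
  moreover have "norm ((-1) ^ n * (bdiff ^^ K) (abel_term a s x) n) \<le> C * real (Suc n) powr (- 2)"
    if "norm s \<le> R" "Re s \<ge> \<sigma>" "x \<ge> 0" for s x n
  proof -
    have "norm ((-1) ^ n * (bdiff ^^ K) (abel_term a s x) n) \<le> C * real (Suc n) powr (1 - \<sigma> - real K)"
      using C(2)[OF that] by (simp add: norm_mult norm_power)
    also have "\<dots> \<le> C * real (Suc n) powr (- 2)"
      using assms(2) C(1) by (intro mult_left_mono powr_mono) auto
    finally show ?thesis .
  qed
  ultimately show ?thesis by (rule that)
qed

lemma funpow_bdiff_tendsto_0:
  fixes f :: "nat \<Rightarrow> complex"
  assumes "f \<longlonglongrightarrow> 0"
  shows "(bdiff ^^ j) f \<longlonglongrightarrow> 0"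
proof (induction j)
  case (Suc j)
  have "(\<lambda>n. (bdiff ^^ j) f n - (bdiff ^^ j) f (Suc n)) \<longlonglongrightarrow> 0 - 0"
    by (intro tendsto_diff Suc LIMSEQ_Suc)
  then show ?case by (simp add: bdiff_def[abs_def])
qed (use assms in simp)

text \<open>For x > 0 the exponential beats any power, so \<rho> = 1 will do; for x = 0 the choice
  \<rho> = Re s / 2 leaves a negative exponent.\<close>

lemma abel_term_tendsto_0:
  assumes "slow a" "x > 0 \<or> x = 0 \<and> Re s > 0"
  shows "abel_term a s x \<longlonglongrightarrow> 0"
proof -
  have ex: "\<exists>\<rho>>0. (\<lambda>n. real (Suc n) powr (\<rho> - Re s) * exp (- (real (Suc n) * x))) \<longlonglongrightarrow> 0"
    using assms(2)
  proof
    assume "x > 0"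
    then have "(\<lambda>n. real (Suc n) powr (1 - Re s) * exp (- (real (Suc n) * x))) \<longlonglongrightarrow> 0"
      by real_asymp
    then show ?thesis by (intro exI[of _ 1]) auto
  next
    assume *: "x = 0 \<and> Re s > 0"
    have "(\<lambda>n. real (Suc n) powr (- (Re s / 2))) \<longlonglongrightarrow> 0"
      using * by real_asymp
    with * show ?thesis by (intro exI[of _ "Re s / 2"]) auto
  qed
  then obtain \<rho> where \<rho>: "\<rho> > 0" "(\<lambda>n. real (Suc n) powr (\<rho> - Re s) * exp (- (real (Suc n) * x))) \<longlonglongrightarrow> 0"
    by blast
  obtain C where "C \<ge> 0" and C: "\<And>n. norm (abel_term a s 0 n) \<le> C * real (Suc n) powr (\<rho> - Re s)"
    by (rule abel_term_bound[OF assms(1) \<rho>(1), of "norm s" "Re s" 0]) auto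
  show ?thesis
  proof (rule Lim_null_comparison)
    show "(\<lambda>n. C * (real (Suc n) powr (\<rho> - Re s) * exp (- (real (Suc n) * x)))) \<longlonglongrightarrow> 0"
      using tendsto_mult[OF tendsto_const \<rho>(2), of C] by simp
    have "norm (abel_term a s x n) \<le> C * (real (Suc n) powr (\<rho> - Re s) * exp (- (real (Suc n) * x)))" for n
    proof -
      have "norm (abel_term a s x n) = norm (abel_term a s 0 n) * exp (- (real (Suc n) * x))"
        unfolding abel_term_def norm_mult norm_of_real by simp
      then show ?thesis using C[of n] by (simp add: mult_right_mono flip: mult.assoc)
    qed
    then show "\<forall>\<^sub>F n in sequentially. norm (abel_term a s x n) \<le>
        C * (real (Suc n) powr (\<rho> - Re s) * exp (- (real (Suc n) * x)))"
      by simp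
  qed
qed

lemma abel_term_sums:
  assumes "slow a" "x > 0 \<or> x = 0 \<and> Re s > 0" "real K \<ge> 3 - Re s"
  shows "(\<lambda>n. (-1) ^ n * abel_term a s x n) sums euler_sum (abel_term a s x) K"
proof (rule euler_sums)
  show "(bdiff ^^ j) (abel_term a s x) \<longlonglongrightarrow> 0" for j
    using assms by (intro funpow_bdiff_tendsto_0 abel_term_tendsto_0)
  obtain M where "summable M" "\<And>n. norm ((-1) ^ n * (bdiff ^^ K) (abel_term a s x) n) \<le> M n"
    by (rule abel_term_bound_summable[OF assms(1,3), of "norm s"]) (use assms(2) in auto)
  then show "summable (\<lambda>n. (-1) ^ n * (bdiff ^^ K) (abel_term a s x) n)"
    by (rule summable_comparison_test'[where N = 0])
qed

text \<open>After K Euler steps the series has a summable majorant independent of x, so Tannery's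
  theorem permits the termwise limit. The untransformed series need not have such a
  majorant.\<close>

lemma abel_sum_tendsto_euler_sum:
  assumes "slow a" "real K \<ge> 3 - Re s"
  shows "((\<lambda>x. \<Sum>n. (-1) ^ n * abel_term a s x n) \<longlongrightarrow> euler_sum (abel_term a s 0) K) (at_right 0)"
proof -
  have lim: "((\<lambda>x. (bdiff ^^ j) (abel_term a s x) n) \<longlongrightarrow> (bdiff ^^ j) (abel_term a s 0) n) (at_right 0)" for j n
  proof (induction j arbitrary: n)
    case 0
    show ?case by (auto simp: abel_term_def intro!: tendsto_eq_intros)
  next
    case (Suc j)
    then show ?case by (simp add: bdiff_def tendsto_diff)
  qed
  obtain M where M: "summable M"
      "\<And>x n. x \<ge> 0 \<Longrightarrow> norm ((-1) ^ n * (bdiff ^^ K) (abel_term a s x) n) \<le> M n"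
    by (rule abel_term_bound_summable[OF assms, of "norm s"]) auto
  have "eventually (\<lambda>x::real. x > 0) (at_right 0)"
    by (rule eventually_at_right_less)
  then have "\<forall>\<^sub>F (n, x) in sequentially \<times>\<^sub>F at_right 0.
      norm ((-1) ^ n * (bdiff ^^ K) (abel_term a s x) n) \<le> M n"
    unfolding eventually_prod_filter using M(2)
    by (intro exI[of _ "\<lambda>_. True"] exI[of _ "\<lambda>x. x > 0"]) auto
  from tannerys_theorem[OF tendsto_mult[OF tendsto_const lim] this M(1)]
  have "((\<lambda>x. \<Sum>n. (-1) ^ n * (bdiff ^^ K) (abel_term a s x) n) \<longlongrightarrow>
      (\<Sum>n. (-1) ^ n * (bdiff ^^ K) (abel_term a s 0) n)) (at_right 0)"
    by auto
  then have "((\<lambda>x. euler_sum (abel_term a s x) K) \<longlongrightarrow> euler_sum (abel_term a s 0) K) (at_right 0)"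
    unfolding euler_sum_def by (intro tendsto_intros lim) auto
  moreover have "\<forall>\<^sub>F x in at_right 0. euler_sum (abel_term a s x) K = (\<Sum>n. (-1) ^ n * abel_term a s x n)"
    using eventually_at_right_less[of 0]
    by eventually_elim (use abel_term_sums[OF assms(1) _ assms(2)] sums_unique in blast)
  ultimately show ?thesis
    by (rule Lim_transform_eventually)
qed

text \<open>The remaining series is a locally uniform limit of entire partial sums, by the
  Weierstrass test with the majorant of \<open>abel_term_bound_summable\<close>.\<close>

lemma holomorphic_euler_sum:
  assumes "slow a"
  shows "(\<lambda>s. euler_sum (abel_term a s 0) K) holomorphic_on {s. Re s > 3 - real K}"
proof -
  let ?S = "{s :: complex. Re s > 3 - real K}"
  have hol: "(\<lambda>s. (bdiff ^^ j) (abel_term a s 0) n) holomorphic_on A" for j n A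
  proof (induction j arbitrary: n)
    case 0
    show ?case by (auto simp: abel_term_def intro!: holomorphic_intros)
  next
    case (Suc j)
    then show ?case by (simp add: bdiff_def holomorphic_on_diff)
  qed
  have "(\<lambda>s. \<Sum>n. (-1) ^ n * (bdiff ^^ K) (abel_term a s 0) n) holomorphic_on ?S"
  proof (rule holomorphic_uniform_sequence)
    show "open ?S" by (rule open_halfspace_Re_gt)
    show "(\<lambda>s. \<Sum>n<N. (-1) ^ n * (bdiff ^^ K) (abel_term a s 0) n) holomorphic_on ?S" for N
      by (intro holomorphic_intros hol)
    fix z assume z: "z \<in> ?S"
    \<comment> \<open>Half the distance from z to the boundary line, so that the closed ball stays
      inside the half-plane.\<close>
    define d where "d = (Re z - (3 - real K)) / 2"
    have Re: "Re s \<ge> Re z - d" and norm: "norm s \<le> norm z + d" if "s \<in> cball z d" for s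
    proof -
      have "\<bar>Re z - Re s\<bar> \<le> norm (z - s)"
        using abs_Re_le_cmod[of "z - s"] by simp
      with that show "Re s \<ge> Re z - d" by (simp add: dist_norm)
      show "norm s \<le> norm z + d"
        using that norm_triangle_ineq2[of s z] by (simp add: dist_norm norm_minus_commute)
    qed
    have d: "d > 0" "3 - real K \<le> Re z - d" "Re z - d > 3 - real K"
      using z by (auto simp: d_def field_simps)
    obtain M where M: "summable M" "\<And>s x n. norm s \<le> norm z + d \<Longrightarrow> Re s \<ge> Re z - d \<Longrightarrow> x \<ge> 0 \<Longrightarrow>
        norm ((-1) ^ n * (bdiff ^^ K) (abel_term a s x) n) \<le> M n"
      by (rule abel_term_bound_summable[OF assms, of "Re z - d" K "norm z + d"]) (use d in auto)
    have "uniform_limit (cball z d) (\<lambda>N s. \<Sum>n<N. (-1) ^ n * (bdiff ^^ K) (abel_term a s 0) n)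
        (\<lambda>s. \<Sum>n. (-1) ^ n * (bdiff ^^ K) (abel_term a s 0) n) sequentially"
      using M(1) by (rule Weierstrass_m_test[rotated]) (use Re norm M(2) in auto)
    moreover have "cball z d \<subseteq> ?S"
      using Re d by fastforce
    ultimately show "\<exists>d>0. cball z d \<subseteq> ?S \<and> uniform_limit (cball z d)
        (\<lambda>N s. \<Sum>n<N. (-1) ^ n * (bdiff ^^ K) (abel_term a s 0) n)
        (\<lambda>s. \<Sum>n. (-1) ^ n * (bdiff ^^ K) (abel_term a s 0) n) sequentially"
      using d by blast
  qed
  then show ?thesis
    unfolding euler_sum_def by (intro holomorphic_intros hol) auto
qed

theorem alt_dirichlet:
  assumes "slow a"
  shows continues_alt_dirichlet_alt_dirichlet: "continues_alt_dirichlet a (alt_dirichlet a)"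
    and abel_sum_tendsto_alt_dirichlet:
      "((\<lambda>x. \<Sum>n. (-1) ^ n * abel_term a s x n) \<longlongrightarrow> alt_dirichlet a s) (at_right 0)"
proof -
  \<comment> \<open>The Abel limit does not mention K, so the formulas on the half-planes for
    different K agree automatically and glue to an entire function.\<close>
  define f where "f s = Lim (at_right 0) (\<lambda>x. \<Sum>n. (-1) ^ n * abel_term a s x n)" for s
  have f_eq: "f s = euler_sum (abel_term a s 0) K" if "real K \<ge> 3 - Re s" for s K
    unfolding f_def by (intro tendsto_Lim abel_sum_tendsto_euler_sum assms that) auto
  have ex_K: "\<exists>K. real K > 3 - Re s" for s
    by (rule reals_Archimedean2)
  have "f holomorphic_on UNIV"
  proof -
    have "f field_differentiable at s" for s
    proof -
      obtain K where K: "real K > 3 - Re s" using ex_K by blast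
      have "f holomorphic_on {s. Re s > 3 - real K}"
        by (rule holomorphic_transform[OF holomorphic_euler_sum[OF assms, of K]]) (auto intro!: f_eq[symmetric])
      then show ?thesis
        using K by (intro holomorphic_on_imp_differentiable_at[OF _ open_halfspace_Re_gt]) auto
    qed
    then show ?thesis by (simp add: holomorphic_on_def field_differentiable_at_within)
  qed
  moreover have "(\<lambda>n. (-1) ^ n * a (Suc n) * of_nat (Suc n) powr (- s)) sums f s" if "Re s > 0" for s
  proof -
    obtain K where K: "real K \<ge> 3 - Re s" using ex_K less_imp_le by blast
    from abel_term_sums[OF assms _ K, of 0] that show ?thesis
      by (simp add: f_eq[OF K] abel_term_def mult_ac)
  qed
  ultimately have f: "continues_alt_dirichlet a f"
    by (simp add: continues_alt_dirichlet_def)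
  then have eq: "alt_dirichlet a = f"
    unfolding alt_dirichlet_def by (blast intro: the_equality continues_alt_dirichlet_unique)
  with f show "continues_alt_dirichlet a (alt_dirichlet a)" by simp
  obtain K where K: "real K \<ge> 3 - Re s" using ex_K less_imp_le by blast
  show "((\<lambda>x. \<Sum>n. (-1) ^ n * abel_term a s x n) \<longlongrightarrow> alt_dirichlet a s) (at_right 0)"
    using abel_sum_tendsto_euler_sum[OF assms K] by (simp add: eq f_eq[OF K])
qed

section \<open>Taylor coefficients and values of the continuation\<close>

text \<open>The generating series in z = exp (-x), now indexed by n itself. Since
  \<open>0 powr w = 0\<close>, the constant coefficient vanishes, even for s = 0.\<close>

definition alt_fps :: "(nat \<Rightarrow> complex) \<Rightarrow> complex \<Rightarrow> complex fps" where
  "alt_fps a s = Abs_fps (\<lambda>n. - ((-1) ^ n) * a n * of_nat n powr (- s))"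

lemma alt_fps_nth: "fps_nth (alt_fps a s) n = - ((-1) ^ n) * a n * of_nat n powr (- s)"
  by (simp add: alt_fps_def)

lemma alt_fps_term:
  "fps_nth (alt_fps a s) (Suc n) * exp (- of_real x) ^ Suc n = (-1) ^ n * abel_term a s x n"
proof -
  have "exp (- complex_of_real x) ^ Suc n = of_real (exp (- (real (Suc n) * x)))"
    unfolding exp_of_nat_mult[symmetric] exp_of_real[symmetric] by simp
  then show ?thesis
    by (simp add: alt_fps_nth abel_term_def)
qed

lemma alt_fps_sums:
  assumes "slow a" "x > 0"
  shows "(\<lambda>n. fps_nth (alt_fps a s) n * exp (- of_real x) ^ n) sums (\<Sum>n. (-1) ^ n * abel_term a s x n)"
proof -
  obtain K where "real K > 3 - Re s"
    using reals_Archimedean2 by blast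
  then have "(\<lambda>n. (-1) ^ n * abel_term a s x n) sums (\<Sum>n. (-1) ^ n * abel_term a s x n)"
    using assms abel_term_sums[of a x s K] by (auto simp: sums_iff)
  then show ?thesis
    unfolding alt_fps_term[symmetric] by (subst (asm) sums_Suc_iff) (simp add: alt_fps_nth)
qed

lemma eval_alt_fps_of_real:
  assumes "slow a" "x > 0"
  shows "eval_fps (alt_fps a s) (exp (- of_real x)) = (\<Sum>n. (-1) ^ n * abel_term a s x n)"
  unfolding eval_fps_def using alt_fps_sums[OF assms] by (simp add: sums_iff)

text \<open>The points exp (-x) with x > 0 exhaust the interval (0, 1), and convergence there
  determines the bound on the radius.\<close>

lemma conv_radius_alt_fps:
  assumes "slow a"
  shows "fps_conv_radius (alt_fps a s) \<ge> 1"
  unfolding fps_conv_radius_def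
proof (rule conv_radius_geI_ex')
  fix r :: real assume r: "0 < r" "ereal r < 1"
  then have "exp (- of_real (- ln r)) = complex_of_real r"
    by (simp add: exp_of_real)
  moreover have "- ln r > 0"
    using r by (simp add: one_ereal_def)
  ultimately show "summable (\<lambda>n. fps_nth (alt_fps a s) n * complex_of_real r ^ n)"
    using alt_fps_sums[OF assms, of "- ln r" s] by (auto simp: sums_iff)
qed

lemma norm_less_conv_radius_alt_fps:
  assumes "slow a" "norm z < 1"
  shows "ereal (norm z) < fps_conv_radius (alt_fps a s)"
  using conv_radius_alt_fps[OF assms(1), of s] assms(2) by (auto simp: one_ereal_def intro: less_le_trans[of _ "ereal 1"])

text \<open>The operator z d/dz multiplies the n-th coefficient by n.\<close>

lemma fps_deriv_alt_fps: "fps_X * fps_deriv (alt_fps a s) = alt_fps a (s - 1)"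
proof (rule fps_ext)
  fix n
  show "fps_nth (fps_X * fps_deriv (alt_fps a s)) n = fps_nth (alt_fps a (s - 1)) n"
  proof (cases n)
    case (Suc m)
    have "of_nat (Suc m) powr (1 + - s) = of_nat (Suc m) * of_nat (Suc m) powr (- s :: complex)"
      by (subst powr_add) simp
    then show ?thesis
      by (simp add: Suc fps_X_mult_nth alt_fps_nth mult_ac)
  qed (simp add: alt_fps_nth)
qed

text \<open>Under z = exp (-x) the derivative d/dx becomes -z d/dz.\<close>

lemma has_field_derivative_eval_alt_fps:
  assumes "slow a" "Re x > 0"
  shows "((\<lambda>x. eval_fps (alt_fps a s) (exp (- x))) has_field_derivative
    - eval_fps (alt_fps a (s - 1)) (exp (- x))) (at x)"
proof -
  let ?f = "alt_fps a s" and ?z = "exp (- x)"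
  have z: "ereal (norm ?z) < fps_conv_radius ?f"
    using assms by (intro norm_less_conv_radius_alt_fps) auto
  have "(eval_fps ?f has_field_derivative eval_fps (fps_deriv ?f) ?z) (at ?z)"
    using z by (rule has_field_derivative_eval_fps)
  moreover have "((\<lambda>x. exp (- x)) has_field_derivative - ?z) (at x)"
    by (auto intro!: derivative_eq_intros)
  ultimately have "((\<lambda>x. eval_fps ?f (exp (- x))) has_field_derivative
      eval_fps (fps_deriv ?f) ?z * - ?z) (at x)"
    by (rule DERIV_chain2)
  also have "eval_fps (fps_deriv ?f) ?z * - ?z = - eval_fps (fps_X * fps_deriv ?f) ?z"
    using less_le_trans[OF z fps_conv_radius_deriv] by (subst eval_fps_mult) auto
  finally show ?thesis by (simp only: fps_deriv_alt_fps)
qed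

text \<open>The function continues the damped series from the right half of the ball across the
  imaginary axis. Radius 1 keeps clear of the zeros of 1 + exp (-x), the nearest of which are
  \<plusminus>\<pi>\<i>.\<close>

definition extends :: "(nat \<Rightarrow> complex) \<Rightarrow> complex \<Rightarrow> (complex \<Rightarrow> complex) \<Rightarrow> bool" where
  "extends a s \<Phi> \<longleftrightarrow> \<Phi> holomorphic_on ball 0 1 \<and>
     (\<forall>x\<in>ball 0 1. Re x > 0 \<longrightarrow> \<Phi> x = eval_fps (alt_fps a s) (exp (- x)))"

lemma open_convex_half_ball:
  shows "open (ball 0 1 \<inter> {x :: complex. Re x > 0})"
    and "convex (ball 0 1 \<inter> {x :: complex. Re x > 0})"
  by (auto intro!: open_Int open_halfspace_Re_gt convex_Int convex_halfspace_Re_gt)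

lemma extends_deriv:
  assumes "slow a" "extends a s \<Phi>"
  shows "extends a (s - 1) (\<lambda>x. - deriv \<Phi> x)"
  unfolding extends_def
proof (intro conjI ballI impI)
  show "(\<lambda>x. - deriv \<Phi> x) holomorphic_on ball 0 1"
    using assms(2) unfolding extends_def by (intro holomorphic_intros holomorphic_deriv) auto
  fix x :: complex assume x: "x \<in> ball 0 1" "Re x > 0"
  have "(\<Phi> has_field_derivative - eval_fps (alt_fps a (s - 1)) (exp (- x))) (at x)"
    using has_field_derivative_eval_alt_fps[OF assms(1) x(2)] open_convex_half_ball(1)
    by (rule has_field_derivative_transform_within_open) (use x assms(2) in \<open>auto simp: extends_def\<close>)
  then show "- deriv \<Phi> x = eval_fps (alt_fps a (s - 1)) (exp (- x))"
    by (simp add: DERIV_imp_deriv)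
qed

text \<open>Both sides are the limit of the damped series along the positive real axis, one by
  continuity and one by Abel summation.\<close>

lemma extends_at_0:
  assumes "slow a" "extends a s \<Phi>"
  shows "\<Phi> 0 = alt_dirichlet a s"
proof (rule tendsto_unique)
  have "isCont \<Phi> 0"
    using assms(2) unfolding extends_def
    by (meson centre_in_ball continuous_on_interior field_differentiable_imp_continuous_at
        holomorphic_on_imp_differentiable_at open_ball zero_less_one)
  moreover have "((\<lambda>x. complex_of_real x) \<longlongrightarrow> 0) (at_right 0)"
    by (auto intro!: tendsto_eq_intros)
  ultimately show "((\<lambda>x. \<Phi> (of_real x)) \<longlongrightarrow> \<Phi> 0) (at_right 0)"
    by (rule isCont_tendsto_compose)
  have "\<forall>\<^sub>F x in at_right (0 :: real). x \<in> {0<..<1}"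
    by (rule eventually_at_right_real) simp
  then have "\<forall>\<^sub>F x in at_right 0. (\<Sum>n. (-1) ^ n * abel_term a s x n) = \<Phi> (of_real x)"
  proof eventually_elim
    case (elim x)
    then have "\<Phi> (of_real x) = eval_fps (alt_fps a s) (exp (- of_real x))"
      using assms(2) unfolding extends_def by auto
    with elim assms(1) show ?case
      by (simp add: eval_alt_fps_of_real)
  qed
  then show "((\<lambda>x. \<Phi> (of_real x)) \<longlongrightarrow> alt_dirichlet a s) (at_right 0)"
    using abel_sum_tendsto_alt_dirichlet[OF assms(1)] by (rule Lim_transform_eventually[rotated])
qed simp

text \<open>Each derivative lowers s by one and contributes a sign, by \<open>extends_deriv\<close>;
  the value at 0 is then \<open>extends_at_0\<close>.\<close>

lemma higher_deriv_extends:
  assumes "slow a" "extends a s \<Phi>"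
  shows "(deriv ^^ k) \<Phi> 0 = (-1) ^ k * alt_dirichlet a (s - of_nat k)"
  using assms(2)
proof (induction k arbitrary: s \<Phi>)
  case 0
  then show ?case by (simp add: extends_at_0[OF assms(1)])
next
  case (Suc k)
  have hol: "deriv \<Phi> holomorphic_on ball 0 1"
    using Suc.prems unfolding extends_def by (intro holomorphic_deriv) auto
  have "(deriv ^^ Suc k) \<Phi> 0 = - (deriv ^^ k) (\<lambda>x. - deriv \<Phi> x) 0"
    unfolding funpow_Suc_right o_def by (subst higher_deriv_uminus[OF hol]) auto
  also have "\<dots> = (-1) ^ Suc k * alt_dirichlet a (s - of_nat (Suc k))"
    by (subst Suc.IH[OF extends_deriv[OF assms(1) Suc.prems]]) (simp add: algebra_simps)
  finally show ?case .
qed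

lemma extends_sums:
  assumes "slow a" "extends a s \<Phi>" "norm w < 1"
  shows "(\<lambda>k. alt_dirichlet a (s - of_nat k) * (- w) ^ k / fact k) sums \<Phi> w"
proof -
  have "(\<lambda>k. (deriv ^^ k) \<Phi> 0 / fact k * (w - 0) ^ k) sums \<Phi> w"
    using assms(2,3) unfolding extends_def by (intro holomorphic_power_series[where r = 1]) auto
  moreover have "(- w) ^ k = (-1) ^ k * w ^ k" for k
    by (rule power_minus)
  ultimately show ?thesis
    by (simp add: higher_deriv_extends[OF assms(1,2)] mult_ac)
qed

lemma i_times_power_even: "(\<i> * z) ^ (2 * n) = (-1) ^ n * z ^ (2 * n)"
  by (simp only: power_mult_distrib[of \<i> z "2 * n"] power_mult[of \<i> 2 n] power2_i)

text \<open>Averaging the Taylor series at the two points \<plusminus>\<i>\<theta> cancels the odd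
  powers, and even powers of \<i> supply the signs.\<close>

lemma extends_sums_even:
  assumes "slow a" "extends a s \<Phi>" "\<bar>\<theta>\<bar> < 1"
  shows "(\<lambda>n. (-1) ^ n * of_real \<theta> ^ (2 * n) / fact (2 * n) * alt_dirichlet a (s - 2 * of_nat n))
    sums ((\<Phi> (- \<i> * of_real \<theta>) + \<Phi> (\<i> * of_real \<theta>)) / 2)"
proof -
  let ?f = "\<lambda>k. (alt_dirichlet a (s - of_nat k) * (- (- \<i> * of_real \<theta>)) ^ k / fact k +
    alt_dirichlet a (s - of_nat k) * (- (\<i> * of_real \<theta>)) ^ k / fact k) / 2"
  have "?f sums ((\<Phi> (- \<i> * of_real \<theta>) + \<Phi> (\<i> * of_real \<theta>)) / 2)"
    using assms by (intro sums_divide sums_add extends_sums) (auto simp: norm_mult)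
  moreover have "?f k = 0" if "k \<notin> range (\<lambda>n. 2 * n)" for k
  proof -
    from that have "odd k" by (auto elim: evenE)
    then show ?thesis by simp
  qed
  ultimately have "(\<lambda>n. ?f (2 * n)) sums ((\<Phi> (- \<i> * of_real \<theta>) + \<Phi> (\<i> * of_real \<theta>)) / 2)"
    by (subst sums_mono_reindex) (auto simp: strict_mono_def)
  moreover have "?f (2 * n) = (-1) ^ n * of_real \<theta> ^ (2 * n) / fact (2 * n) *
      alt_dirichlet a (s - 2 * of_nat n)" for n
  proof -
    have "?f (2 * n) = alt_dirichlet a (s - of_nat (2 * n)) * (\<i> * of_real \<theta>) ^ (2 * n) / fact (2 * n)"
      by simp
    then show ?thesis unfolding i_times_power_even by simp
  qed
  ultimately show ?thesis by (simp only:)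
qed

text \<open>Here the even powers cancel. The value at -\<i>\<theta> comes first because
  \<open>extends_sums\<close> is a series in powers of -w.\<close>

lemma extends_sums_odd:
  assumes "slow a" "extends a s \<Phi>" "\<bar>\<theta>\<bar> < 1"
  shows "(\<lambda>n. (-1) ^ n * of_real \<theta> ^ (2 * n + 1) / fact (2 * n + 1) *
      alt_dirichlet a (s - 2 * of_nat n - 1))
    sums ((\<Phi> (- \<i> * of_real \<theta>) - \<Phi> (\<i> * of_real \<theta>)) / (2 * \<i>))"
proof -
  let ?f = "\<lambda>k. (alt_dirichlet a (s - of_nat k) * (- (- \<i> * of_real \<theta>)) ^ k / fact k -
    alt_dirichlet a (s - of_nat k) * (- (\<i> * of_real \<theta>)) ^ k / fact k) / (2 * \<i>)"
  have "?f sums ((\<Phi> (- \<i> * of_real \<theta>) - \<Phi> (\<i> * of_real \<theta>)) / (2 * \<i>))"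
    using assms by (intro sums_divide sums_diff extends_sums) (auto simp: norm_mult)
  moreover have "?f k = 0" if "k \<notin> range (\<lambda>n. 2 * n + 1)" for k
  proof -
    from that have "even k" by (metis oddE rangeI)
    then show ?thesis by simp
  qed
  ultimately have "(\<lambda>n. ?f (2 * n + 1)) sums ((\<Phi> (- \<i> * of_real \<theta>) - \<Phi> (\<i> * of_real \<theta>)) / (2 * \<i>))"
    by (subst sums_mono_reindex) (auto simp: strict_mono_def)
  moreover have "?f (2 * n + 1) = (-1) ^ n * of_real \<theta> ^ (2 * n + 1) / fact (2 * n + 1) *
      alt_dirichlet a (s - 2 * of_nat n - 1)" for n
  proof -
    have "?f (2 * n + 1) = alt_dirichlet a (s - of_nat (2 * n + 1)) * (\<i> * of_real \<theta>) ^ (2 * n + 1) / fact (2 * n + 1) / \<i>"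
      by (simp add: field_simps del: fact_Suc)
    also have "(\<i> * complex_of_real \<theta>) ^ (2 * n + 1) = \<i> * ((-1) ^ n * of_real \<theta> ^ (2 * n + 1))"
      unfolding power_add i_times_power_even by simp
    finally show ?thesis by (simp add: algebra_simps del: fact_Suc)
  qed
  ultimately show ?thesis by (simp only:)
qed

text \<open>A primitive of -\<Phi> exists on the ball and differs from the series by a constant on
  the convex half-ball; subtracting the constant gives the extension. This raises s by one even
  where no elementary closed form is at hand, as for the dilogarithm.\<close>

lemma extends_primitive:
  assumes "slow a" "extends a (s - 1) \<Phi>"
  obtains \<Psi> where "extends a s \<Psi>"
    "\<And>x. x \<in> ball 0 1 \<Longrightarrow> (\<Psi> has_field_derivative - \<Phi> x) (at x)"
proof -
  let ?U = "ball 0 1 \<inter> {x :: complex. Re x > 0}"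
  have "(\<lambda>x. - \<Phi> x) holomorphic_on ball 0 1"
    using assms(2) unfolding extends_def by (intro holomorphic_intros) auto
  then obtain g where "\<And>x. x \<in> ball 0 1 \<Longrightarrow> (g has_field_derivative - \<Phi> x) (at x within ball 0 1)"
    by (rule holomorphic_convex_primitive'[OF convex_ball open_ball]) blast
  then have g: "(g has_field_derivative - \<Phi> x) (at x)" if "x \<in> ball 0 1" for x
    using that by (metis at_within_open open_ball)
  have "((\<lambda>x. g x - eval_fps (alt_fps a s) (exp (- x))) has_field_derivative 0) (at x within ?U)"
    if "x \<in> ?U" for x
    using DERIV_diff[OF g has_field_derivative_eval_alt_fps[OF assms(1)], of x s] that assms(2)
    by (auto simp: extends_def intro: has_field_derivative_at_within)
  from has_field_derivative_zero_constant[OF open_convex_half_ball(2) this]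
  obtain c where c: "\<And>x. x \<in> ?U \<Longrightarrow> g x - eval_fps (alt_fps a s) (exp (- x)) = c"
    by blast
  have deriv: "((\<lambda>x. g x - c) has_field_derivative - \<Phi> x) (at x)" if "x \<in> ball 0 1" for x
    using DERIV_diff[OF g[OF that] DERIV_const] by simp
  moreover have "extends a s (\<lambda>x. g x - c)"
    unfolding extends_def
  proof (intro conjI ballI impI)
    show "(\<lambda>x. g x - c) holomorphic_on ball 0 1"
      using deriv by (meson field_differentiable_at_within field_differentiable_def holomorphic_on_def)
  qed (use c in \<open>auto simp: algebra_simps\<close>)
  ultimately show ?thesis by (intro that)
qed

section \<open>Formal power series identities for the coefficient sequences 1, H and H^2\<close>

lemma alt_fps_one_0: "(1 + fps_X) * alt_fps (\<lambda>_. 1) 0 = fps_X"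
proof (rule fps_ext)
  fix n
  show "fps_nth ((1 + fps_X) * alt_fps (\<lambda>_. 1) 0) n = fps_nth fps_X n"
  proof (cases n)
    case (Suc m)
    then show ?thesis
      by (cases m) (simp_all add: distrib_right fps_X_mult_nth alt_fps_nth del: of_nat_Suc)
  qed (simp add: alt_fps_nth)
qed

lemma one_plus_X_times_nth_Suc:
  fixes f :: "'a::comm_ring_1 fps"
  shows "fps_nth ((1 + fps_X) * f) (Suc n) = fps_nth f (Suc n) + fps_nth f n"
  by (simp add: distrib_right fps_X_mult_nth)

text \<open>At s = 0 the factor \<open>of_nat n powr 0\<close> is 1 except at n = 0, where it is 0;
  this is why \<open>a 0 = 0\<close> is assumed.\<close>

lemma alt_fps_0_nth: "a 0 = 0 \<Longrightarrow> fps_nth (alt_fps a 0) n = - ((-1) ^ n) * a n"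
  by (cases n) (simp_all add: alt_fps_nth del: of_nat_Suc)

lemma harm_0: "harm 0 = 0"
  by (simp add: harm_def)

text \<open>Because the signs alternate, multiplication by 1 + z replaces a(n) by a(n) - a(n - 1),
  which is 1/n for the harmonic numbers.\<close>

lemma alt_fps_harm_0: "(1 + fps_X) * alt_fps harm 0 = alt_fps (\<lambda>_. 1) 1"
proof (rule fps_ext)
  fix n
  show "fps_nth ((1 + fps_X) * alt_fps harm 0) n = fps_nth (alt_fps (\<lambda>_. 1) 1) n"
  proof (cases n)
    case (Suc m)
    then show ?thesis
      by (simp add: one_plus_X_times_nth_Suc alt_fps_0_nth alt_fps_nth harm_0 harm_Suc powr_minus
          algebra_simps del: of_nat_Suc)
  qed (simp add: alt_fps_nth)
qed

lemma powr_minus_two: "(z :: complex) powr (- 2) = inverse z ^ 2"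
  by (cases "z = 0") (simp_all add: powr_minus power_inverse)

text \<open>The difference of the squares of H(n) and H(n) - 1/n is 2 H(n)/n - 1/n^2.\<close>

lemma alt_fps_harm_power2_0:
  "(1 + fps_X) * alt_fps (\<lambda>n. harm n ^ 2) 0 = 2 * alt_fps harm 1 - alt_fps (\<lambda>_. 1) 2"
proof (rule fps_ext)
  fix n
  show "fps_nth ((1 + fps_X) * alt_fps (\<lambda>n. harm n ^ 2) 0) n =
      fps_nth (2 * alt_fps harm 1 - alt_fps (\<lambda>_. 1) 2) n"
  proof (cases n)
    case (Suc m)
    then show ?thesis
      by (simp add: one_plus_X_times_nth_Suc alt_fps_0_nth alt_fps_nth harm_0 harm_Suc powr_minus
          powr_minus_two fps_numeral_fps_const power2_eq_square algebra_simps
          del: of_nat_Suc)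
  qed (simp add: alt_fps_nth fps_numeral_fps_const)
qed

text \<open>This is the power series identity \<open>\<Sum>(-1)\<^sup>n H\<^bsub>n-1\<^esub> z\<^sup>n / n = ln\<^sup>2(1 + z) / 2\<close>, obtained by comparing derivatives.\<close>

lemma alt_fps_harm_1: "2 * alt_fps harm 1 - alt_fps (\<lambda>_. 1) 2 = alt_fps (\<lambda>_. 1) 2 - alt_fps (\<lambda>_. 1) 1 ^ 2"
proof -
  define L where "L = alt_fps (\<lambda>_. 1) 1"
  define W where "W = 2 * alt_fps harm 1 - 2 * alt_fps (\<lambda>_. 1) 2 + L ^ 2"
  have harm: "fps_X * fps_deriv (alt_fps harm 1) = alt_fps harm 0"
    and two: "fps_X * fps_deriv (alt_fps (\<lambda>_. 1) 2) = L"
    and one: "fps_X * fps_deriv L = alt_fps (\<lambda>_. 1) 0"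
    by (simp_all add: fps_deriv_alt_fps L_def)
  have "fps_X * ((1 + fps_X) * fps_deriv L) = fps_X * 1"
    using alt_fps_one_0 by (simp add: algebra_simps flip: one)
  then have L': "(1 + fps_X) * fps_deriv L = 1"
    by (simp only: mult_cancel_left) simp
  \<comment> \<open>The factor X(1 + X) turns every derivative into a multiple of L: the three
    contributions are 2L, -2(1 + X)L and 2XL.\<close>
  have "fps_X * ((1 + fps_X) * fps_deriv W) = 2 * ((1 + fps_X) * (fps_X * fps_deriv (alt_fps harm 1)))
      - 2 * (1 + fps_X) * (fps_X * fps_deriv (alt_fps (\<lambda>_. 1) 2)) + 2 * L * fps_X * ((1 + fps_X) * fps_deriv L)"
    by (simp add: W_def fps_deriv_power power2_eq_square algebra_simps)
  also have "\<dots> = 0"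
    unfolding harm two L' alt_fps_harm_0 L_def[symmetric] by (simp add: algebra_simps)
  finally have "fps_X * ((1 + fps_X) * fps_deriv W) = 0" .
  moreover have one_plus_X: "1 + fps_X \<noteq> (0 :: complex fps)"
    by (metis add.right_neutral fps_X_nth fps_add_nth fps_one_nth fps_zero_nth zero_neq_one)
  ultimately have "fps_deriv W = 0"
    using one_plus_X by simp
  moreover have "fps_nth W 0 = 0"
    by (simp add: W_def L_def alt_fps_nth power2_eq_square)
  ultimately have "W = 0"
    by (metis fps_const_0_eq_0 fps_deriv_eq_0_iff)
  then show ?thesis
    by (simp add: W_def L_def algebra_simps)
qed

text \<open>Subtracting the alternating series from that of \<zeta>(2) in consecutive pairs leaves
  twice the even-indexed squares, which is half of \<zeta>(2).\<close>

lemma alternating_inverse_squares_sums: "(\<lambda>n. (-1) ^ n / (real n + 1)\<^sup>2) sums (pi\<^sup>2 / 12)"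
proof -
  let ?f = "\<lambda>n. 1 / (real n + 1)\<^sup>2" and ?g = "\<lambda>n. (-1) ^ n / (real n + 1)\<^sup>2"
  have f: "?f sums (pi\<^sup>2 / 6)"
    using inverse_squares_sums by (simp add: add_ac)
  have "summable ?g"
    by (rule summable_comparison_test'[OF sums_summable[OF f], of 0]) simp
  then obtain A where A: "?g sums A" by (auto simp: summable_def)
  have "(\<lambda>n. sum ?f {n * 2..<n * 2 + 2} - sum ?g {n * 2..<n * 2 + 2}) sums (pi\<^sup>2 / 6 - A)"
    using sums_group[OF f, of 2] sums_group[OF A, of 2] by (intro sums_diff) auto
  moreover have "sum ?f {n * 2..<n * 2 + 2} - sum ?g {n * 2..<n * 2 + 2} = ?f n / 2" for n
  proof -
    have "{n * 2..<n * 2 + 2} = {2 * n, 2 * n + 1}" by auto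
    then show ?thesis by (simp add: divide_simps) (simp add: power2_eq_square algebra_simps)
  qed
  ultimately have "(\<lambda>n. ?f n / 2) sums (pi\<^sup>2 / 6 - A)"
    by simp
  from sums_unique2[OF this sums_divide[OF f]] have "A = pi\<^sup>2 / 12"
    by simp
  with A show ?thesis by simp
qed

section \<open>Closed forms\<close>

text \<open>The imaginary part of x is below \<pi>/2 in absolute value. This keeps the argument of
  \<open>Ln\<close> off its branch cut and the denominators nonzero.\<close>

lemma Re_one_plus_exp_pos:
  assumes "norm (x :: complex) < 1"
  shows "Re (1 + exp (- x)) > 0"
proof -
  have "\<bar>Im x\<bar> < pi / 2"
    using abs_Im_le_cmod[of x] assms pi_gt3 by linarith
  then have "cos (Im x) > 0"
    by (intro cos_gt_zero_pi) auto
  then show ?thesis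
    by (simp add: Re_exp add_pos_pos)
qed

lemma one_plus_exp_nonzero: "norm (x :: complex) < 1 \<Longrightarrow> 1 + exp (- x) \<noteq> 0"
  using Re_one_plus_exp_pos[of x] by (metis less_irrefl zero_complex.sel(1))

lemma one_plus_exp_notin_nonpos: "norm (x :: complex) < 1 \<Longrightarrow> 1 + exp (- x) \<notin> \<real>\<^sub>\<le>\<^sub>0"
  using Re_one_plus_exp_pos[of x] by (auto simp: complex_nonpos_Reals_iff)

lemma norm_exp_uminus_less_1: "Re x > 0 \<Longrightarrow> norm (exp (- x)) < 1"
  by simp

lemma eval_one_plus_X_times:
  assumes "slow a" "norm z < 1"
  shows "eval_fps ((1 + fps_X) * alt_fps a s) z = (1 + z) * eval_fps (alt_fps a s) z"
proof -
  have "fps_conv_radius (1 + fps_X :: complex fps) \<ge> \<infinity>"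
    using fps_conv_radius_add[of "1 :: complex fps" fps_X] by simp
  then show ?thesis
    using norm_less_conv_radius_alt_fps[OF assms, of s]
    by (subst eval_fps_mult) (auto simp: eval_fps_add)
qed

lemma eval_alt_fps_one_1:
  assumes "norm z < 1"
  shows "eval_fps (alt_fps (\<lambda>_. 1) 1) z = Ln (1 + z)"
proof -
  have "fps_nth (alt_fps (\<lambda>_. 1) 1) n * z ^ n = - ((- z) ^ n) / of_nat n" for n
    by (simp add: alt_fps_nth powr_minus power_minus[of z] divide_inverse)
  then show ?thesis
    unfolding eval_fps_def using Ln_series'[OF assms] by (simp add: sums_iff)
qed

lemma eval_alt_fps_two_harm_minus:
  assumes "norm z < 1"
  shows "eval_fps (2 * alt_fps harm 1 - alt_fps (\<lambda>_. 1) 2) z =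
    2 * eval_fps (alt_fps harm 1) z - eval_fps (alt_fps (\<lambda>_. 1) 2) z"
proof -
  note conv = norm_less_conv_radius_alt_fps[OF slow_harm assms, of 1]
    norm_less_conv_radius_alt_fps[OF slow_one assms, of 2]
  have two: "2 * alt_fps harm 1 = alt_fps harm 1 + alt_fps harm 1"
    by simp
  have "ereal (norm z) < fps_conv_radius (2 * alt_fps harm 1)"
    unfolding two using less_le_trans[OF _ fps_conv_radius_add] conv by (metis min.idem)
  moreover have "eval_fps (2 * alt_fps harm 1) z = 2 * eval_fps (alt_fps harm 1) z"
    unfolding two using conv by (subst eval_fps_add) auto
  ultimately show ?thesis
    using conv by (simp add: eval_fps_diff)
qed

lemma eval_alt_fps_harm_1:
  assumes "norm z < 1"
  shows "2 * eval_fps (alt_fps harm 1) z - eval_fps (alt_fps (\<lambda>_. 1) 2) z =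
    eval_fps (alt_fps (\<lambda>_. 1) 2) z - Ln (1 + z) ^ 2"
proof -
  note conv = norm_less_conv_radius_alt_fps[OF slow_one assms]
  have "ereal (norm z) < fps_conv_radius (alt_fps (\<lambda>_. 1) 1 ^ 2)"
    using less_le_trans[OF conv fps_conv_radius_power] .
  then have "eval_fps (alt_fps (\<lambda>_. 1) 2 - alt_fps (\<lambda>_. 1) 1 ^ 2) z =
      eval_fps (alt_fps (\<lambda>_. 1) 2) z - Ln (1 + z) ^ 2"
    using conv by (simp add: eval_fps_diff eval_fps_power eval_alt_fps_one_1[OF assms])
  then show ?thesis
    using eval_alt_fps_two_harm_minus[OF assms] by (simp add: alt_fps_harm_1)
qed

section \<open>Explicit holomorphic extensions\<close>

lemma extends_one_0: "extends (\<lambda>_. 1) 0 (\<lambda>x. 1 - 1 / (1 + exp (- x)))"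
  unfolding extends_def
proof (intro conjI ballI impI)
  show "(\<lambda>x. 1 - 1 / (1 + exp (- x))) holomorphic_on ball 0 1"
    by (intro holomorphic_intros) (auto dest: one_plus_exp_nonzero)
  fix x :: complex assume x: "x \<in> ball 0 1" "Re x > 0"
  have "(1 + exp (- x)) * eval_fps (alt_fps (\<lambda>_. 1) 0) (exp (- x)) = exp (- x)"
    using eval_one_plus_X_times[OF slow_one norm_exp_uminus_less_1[OF x(2)], of 0]
    by (simp add: alt_fps_one_0)
  then show "1 - 1 / (1 + exp (- x)) = eval_fps (alt_fps (\<lambda>_. 1) 0) (exp (- x))"
    using one_plus_exp_nonzero[of x] x by (simp add: field_simps)
qed

lemma extends_one_1: "extends (\<lambda>_. 1) 1 (\<lambda>x. Ln (1 + exp (- x)))"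
  unfolding extends_def
  by (auto intro!: holomorphic_intros one_plus_exp_notin_nonpos simp: eval_alt_fps_one_1)

lemma extends_harm_0: "extends harm 0 (\<lambda>x. Ln (1 + exp (- x)) / (1 + exp (- x)))"
  unfolding extends_def
proof (intro conjI ballI impI)
  show "(\<lambda>x. Ln (1 + exp (- x)) / (1 + exp (- x))) holomorphic_on ball 0 1"
    by (intro holomorphic_intros) (auto dest: one_plus_exp_nonzero one_plus_exp_notin_nonpos)
  fix x :: complex assume x: "x \<in> ball 0 1" "Re x > 0"
  have "(1 + exp (- x)) * eval_fps (alt_fps harm 0) (exp (- x)) = Ln (1 + exp (- x))"
    using eval_one_plus_X_times[OF slow_harm norm_exp_uminus_less_1[OF x(2)], of 0] x
    by (simp add: alt_fps_harm_0 eval_alt_fps_one_1)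
  then show "Ln (1 + exp (- x)) / (1 + exp (- x)) = eval_fps (alt_fps harm 0) (exp (- x))"
    using one_plus_exp_nonzero[of x] x by (simp add: field_simps)
qed

text \<open>The numerator f stays abstract because it occurs in two forms: as 2P - D for the
  recurrence and as D - Ln(1 + exp (-x))^2 for the generating functions.\<close>

lemma extends_harm_power2:
  assumes hol: "f holomorphic_on ball 0 1"
    and eq: "\<And>x. norm x < 1 \<Longrightarrow> Re x > 0 \<Longrightarrow>
      f x = 2 * eval_fps (alt_fps harm 1) (exp (- x)) - eval_fps (alt_fps (\<lambda>_. 1) 2) (exp (- x))"
  shows "extends (\<lambda>n. harm n ^ 2) 0 (\<lambda>x. f x * (1 / (1 + exp (- x))))"
  unfolding extends_def
proof (intro conjI ballI impI)
  show "(\<lambda>x. f x * (1 / (1 + exp (- x)))) holomorphic_on ball 0 1"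
    by (intro holomorphic_intros hol) (auto dest: one_plus_exp_nonzero)
  fix x :: complex assume x: "x \<in> ball 0 1" "Re x > 0"
  have "(1 + exp (- x)) * eval_fps (alt_fps (\<lambda>n. harm n ^ 2) 0) (exp (- x)) = f x"
    using eval_one_plus_X_times[OF slow_power[OF slow_harm] norm_exp_uminus_less_1[OF x(2)], of 2 0] x
    by (simp add: alt_fps_harm_power2_0 eval_alt_fps_two_harm_minus eq)
  then show "f x * (1 / (1 + exp (- x))) = eval_fps (alt_fps (\<lambda>n. harm n ^ 2) 0) (exp (- x))"
    using one_plus_exp_nonzero[of x] x by (simp add: field_simps)
qed

text \<open>The k-th derivative at 0 of (2P - D) / (1 + exp (-x)), expanded by the Leibniz rule;
  each factor has continuation values as its derivatives.\<close>

lemma harmonic_eta_neg: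
  "harmonic_eta 2 (- of_nat k) =
     harmonic_eta 1 (1 - of_nat k) - dirichlet_eta (2 - of_nat k) / 2
     + (\<Sum>j<k. of_nat (k choose j) * dirichlet_eta (of_nat j - of_nat k)
          * (dirichlet_eta (2 - of_nat j) - 2 * harmonic_eta 1 (1 - of_nat j)))"
proof -
  obtain D where D: "extends (\<lambda>_. 1) 2 D"
    by (rule extends_primitive[of "\<lambda>_. 1" 2]) (use slow_one extends_one_1 in auto)
  obtain P where P: "extends harm 1 P"
    by (rule extends_primitive[of harm 1]) (use slow_harm extends_harm_0 in auto)
  let ?f = "\<lambda>x. 2 * P x - D x" and ?g = "\<lambda>x :: complex. 1 / (1 + exp (- x))"
  have hol: "P holomorphic_on ball 0 1" "D holomorphic_on ball 0 1"
    using D P by (auto simp: extends_def)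
  have holf: "?f holomorphic_on ball 0 1"
    by (intro holomorphic_intros hol)
  have holg: "?g holomorphic_on ball 0 1"
    by (intro holomorphic_intros) (auto dest: one_plus_exp_nonzero)
  have derivf: "(deriv ^^ j) ?f 0 = (-1) ^ j * (2 * harmonic_eta 1 (1 - of_nat j) - dirichlet_eta (2 - of_nat j))" for j
  proof -
    have "(deriv ^^ j) ?f 0 = (deriv ^^ j) (\<lambda>x. 2 * P x) 0 - (deriv ^^ j) D 0"
      by (rule higher_deriv_diff) (auto intro!: holomorphic_intros hol)
    also have "(deriv ^^ j) (\<lambda>x. 2 * P x) 0 = 2 * (deriv ^^ j) P 0"
      by (rule higher_deriv_cmult[OF hol(1)]) auto
    finally show ?thesis
      by (simp add: higher_deriv_extends[OF slow_one D] higher_deriv_extends[OF slow_harm P]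
          harmonic_eta_def dirichlet_eta_def algebra_simps)
  qed
  \<comment> \<open>The extension of the \<eta> series at s = 0 is 1 - \<open>?g\<close>; the
    constant 1 disappears for m > 0, so only m = 0 needs its own value.\<close>
  have derivg: "(deriv ^^ m) ?g 0 = (if m = 0 then 1 / 2 else - ((-1) ^ m) * dirichlet_eta (- of_nat m))" for m
  proof (cases "m = 0")
    case False
    have "(deriv ^^ m) (\<lambda>x. 1 - ?g x) 0 = (deriv ^^ m) (\<lambda>x. 1) 0 - (deriv ^^ m) ?g 0"
      by (rule higher_deriv_diff[OF _ holg]) (auto intro!: holomorphic_intros)
    moreover have "(deriv ^^ m) (\<lambda>x. 1 - ?g x) 0 = (-1) ^ m * dirichlet_eta (- of_nat m)"
      using higher_deriv_extends[OF slow_one extends_one_0, of m] by (simp add: dirichlet_eta_def)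
    ultimately show ?thesis using False by simp
  qed simp
  have "extends (\<lambda>n. harm n ^ 2) 0 (\<lambda>x. ?f x * ?g x)"
    using D P by (intro extends_harm_power2 holf) (auto simp: extends_def)
  from higher_deriv_extends[OF slow_power[OF slow_harm] this, of k]
  have "(-1) ^ k * harmonic_eta 2 (- of_nat k) = (deriv ^^ k) (\<lambda>x. ?f x * ?g x) 0"
    by (simp add: harmonic_eta_def)
  also have "\<dots> = (\<Sum>j=0..k. of_nat (k choose j) * (deriv ^^ j) ?f 0 * (deriv ^^ (k - j)) ?g 0)"
    by (rule higher_deriv_mult[OF holf holg]) auto
  also have "\<dots> = (\<Sum>j=0..k. of_nat (k choose j) *
        ((-1) ^ j * (2 * harmonic_eta 1 (1 - of_nat j) - dirichlet_eta (2 - of_nat j))) *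
        (if k - j = 0 then 1 / 2 else - ((-1) ^ (k - j)) * dirichlet_eta (- of_nat (k - j))))"
    (is "_ = (\<Sum>j=0..k. ?t j)")
    by (simp only: derivf derivg)
  also have "\<dots> =
      (-1) ^ k * (harmonic_eta 1 (1 - of_nat k) - dirichlet_eta (2 - of_nat k) / 2
       + (\<Sum>j<k. of_nat (k choose j) * dirichlet_eta (of_nat j - of_nat k)
          * (dirichlet_eta (2 - of_nat j) - 2 * harmonic_eta 1 (1 - of_nat j))))"
  proof -
    have "?t j = (-1) ^ k * (of_nat (k choose j) * dirichlet_eta (of_nat j - of_nat k)
          * (dirichlet_eta (2 - of_nat j) - 2 * harmonic_eta 1 (1 - of_nat j)))" if "j < k" for j
    proof -
      have "(-1) ^ k = (-1) ^ j * (-1 :: complex) ^ (k - j)"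
        using that by (simp flip: power_add)
      with that show ?thesis by (simp add: of_nat_diff algebra_simps)
    qed
    then have "(\<Sum>j<k. ?t j) = (-1) ^ k * (\<Sum>j<k. of_nat (k choose j) * dirichlet_eta (of_nat j - of_nat k)
          * (dirichlet_eta (2 - of_nat j) - 2 * harmonic_eta 1 (1 - of_nat j)))"
      unfolding sum_distrib_left by (intro sum.cong refl) auto
    \<comment> \<open>The summand j = k carries \<open>?g\<close> undifferentiated, with value 1/2,
      and yields the two terms outside the sum of the recurrence.\<close>
    moreover have "(\<Sum>j=0..k. ?t j) = (\<Sum>j<k. ?t j) + ?t k"
      by (simp only: atLeast0AtMost lessThan_Suc_atMost[symmetric] sum.lessThan_Suc)
    ultimately show ?thesis by (simp add: algebra_simps)
  qed
  finally show ?thesis by simp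
qed

section \<open>Values on the imaginary axis and the generating functions\<close>

lemma dirichlet_eta_2: "dirichlet_eta 2 = of_real (pi\<^sup>2 / 12)"
proof -
  have "(\<lambda>n. (-1) ^ n * 1 * of_nat (Suc n) powr (- 2)) sums dirichlet_eta 2"
    using continues_alt_dirichlet_alt_dirichlet[OF slow_one]
    unfolding continues_alt_dirichlet_def dirichlet_eta_def by simp
  moreover have "(-1) ^ n * 1 * of_nat (Suc n) powr (- 2) = complex_of_real ((-1) ^ n / (real n + 1)\<^sup>2)" for n
    by (simp add: powr_minus_two divide_inverse power_inverse add_ac)
  ultimately have "(\<lambda>n. complex_of_real ((-1) ^ n / (real n + 1)\<^sup>2)) sums dirichlet_eta 2"
    by simp
  then show ?thesis
    using sums_of_real[OF alternating_inverse_squares_sums] by (rule sums_unique2)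
qed

text \<open>The parity relation behind the vanishing of \<open>\<eta>\<close> at the negative even integers.\<close>

lemma extends_one_2_even_part:
  assumes D: "extends (\<lambda>_. 1) 2 D"
    and deriv: "\<And>x. x \<in> ball 0 1 \<Longrightarrow> (D has_field_derivative - Ln (1 + exp (- x))) (at x)"
    and x: "norm x < 1"
  shows "D x + D (- x) = x\<^sup>2 / 2 + of_real (pi\<^sup>2 / 6)"
proof -
  \<comment> \<open>This is the factorisation of 1 + exp y as exp y times 1 + exp (-y). Both
    imaginary parts are below \<pi>/2 in absolute value, so no multiple of 2\<pi>\<i>
    appears.\<close>
  have Ln: "Ln (1 + exp y) = y + Ln (1 + exp (- y))" if y: "norm y < 1" for y
  proof (rule Ln_unique)
    show "exp (y + Ln (1 + exp (- y))) = 1 + exp y"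
      using one_plus_exp_nonzero[OF y] by (simp add: exp_add exp_minus field_simps)
    have "\<bar>Im y\<bar> < pi / 2"
      using abs_Im_le_cmod[of y] y pi_gt3 by linarith
    moreover have "\<bar>Im (Ln (1 + exp (- y)))\<bar> < pi / 2"
      using Re_one_plus_exp_pos[OF y] one_plus_exp_nonzero[OF y] by (subst Re_Ln_pos_lt) auto
    ultimately show "- pi < Im (y + Ln (1 + exp (- y)))" "Im (y + Ln (1 + exp (- y))) \<le> pi"
      by auto
  qed
  have "((\<lambda>x. D x + D (- x) - x\<^sup>2 / 2) has_field_derivative 0) (at y within ball 0 1)"
    if "y \<in> ball 0 1" for y
  proof -
    have "((\<lambda>x. D (- x)) has_field_derivative - Ln (1 + exp (- (- y))) * - 1) (at y)"
      by (rule DERIV_chain2[OF deriv]) (use that in \<open>auto intro!: derivative_eq_intros\<close>)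
    moreover have "((\<lambda>x. x\<^sup>2 / 2) has_field_derivative y) (at y)"
      by (auto intro!: derivative_eq_intros)
    ultimately have "((\<lambda>x. D x + D (- x) - x\<^sup>2 / 2) has_field_derivative
        - Ln (1 + exp (- y)) + - Ln (1 + exp (- (- y))) * - 1 - y) (at y)"
      using that by (intro DERIV_add DERIV_diff deriv) auto
    then show ?thesis
      using that Ln[of y] by (simp add: has_field_derivative_at_within)
  qed
  from has_field_derivative_zero_constant[OF convex_ball this]
  obtain c where c: "\<And>y. y \<in> ball 0 1 \<Longrightarrow> D y + D (- y) - y\<^sup>2 / 2 = c"
    by blast
  \<comment> \<open>The constant is found at 0, where it equals 2 D(0) = 2 \<eta>(2).\<close>
  have "D 0 = of_real (pi\<^sup>2 / 12)"
    using extends_at_0[OF slow_one D] dirichlet_eta_2 by (simp add: dirichlet_eta_def)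
  with c[of 0] have "c = of_real (pi\<^sup>2 / 6)"
    by simp
  then have "D x + D (- x) - x\<^sup>2 / 2 = of_real (pi\<^sup>2 / 6)"
    using c[of x] x by simp
  then show ?thesis
    by (simp only: diff_eq_eq add.commute)
qed

text \<open>Both parts come from 1 + exp(\<i>\<theta>) = 2 cos(\<theta>/2) exp(\<i>\<theta>/2), with
  cos(\<theta>/2) positive for small \<theta>.\<close>

lemma one_plus_exp_imaginary:
  fixes \<theta> :: real
  assumes "\<bar>\<theta>\<bar> < 1"
  shows "Ln (1 + exp (\<i> * of_real \<theta>)) = of_real (ln (2 * cos (\<theta> / 2))) + \<i> * of_real \<theta> / 2"
    and "1 / (1 + exp (\<i> * of_real \<theta>)) = (1 - \<i> * of_real (tan (\<theta> / 2))) / 2"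
proof -
  have pos: "cos (\<theta> / 2) > 0"
    using assms pi_gt3 by (intro cos_gt_zero_pi) auto
  let ?c = "complex_of_real (cos (\<theta> / 2))" and ?s = "complex_of_real (sin (\<theta> / 2))"
  have half: "exp (\<i> * of_real \<theta> / 2) = ?c + \<i> * ?s"
    using exp_Euler[of "of_real (\<theta> / 2)"] unfolding cos_of_real sin_of_real by simp
  have "1 + exp (\<i> * of_real \<theta>) = 1 + (?c + \<i> * ?s)\<^sup>2"
    unfolding half[symmetric] by (simp flip: exp_double)
  also have "\<dots> = (?c\<^sup>2 + ?s\<^sup>2) + (?c + \<i> * ?s)\<^sup>2"
    by (simp flip: of_real_power of_real_add)
  also have "\<dots> = 2 * ?c * (?c + \<i> * ?s)"
    by (simp add: power2_eq_square algebra_simps)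
  finally have eq: "1 + exp (\<i> * of_real \<theta>) = 2 * ?c * (?c + \<i> * ?s)" .
  show "Ln (1 + exp (\<i> * of_real \<theta>)) = of_real (ln (2 * cos (\<theta> / 2))) + \<i> * of_real \<theta> / 2"
  proof (rule Ln_unique)
    show "exp (of_real (ln (2 * cos (\<theta> / 2))) + \<i> * of_real \<theta> / 2) = 1 + exp (\<i> * of_real \<theta>)"
      unfolding exp_add half eq using pos by (simp add: exp_of_real)
  qed (use assms pi_gt3 in auto)
  have "(1 - \<i> * of_real (tan (\<theta> / 2))) * (1 + exp (\<i> * of_real \<theta>)) = 2 * (?c - \<i> * ?s) * (?c + \<i> * ?s)"
    unfolding eq using pos by (simp add: tan_def field_simps)
  also have "\<dots> = 2 * (?c\<^sup>2 + ?s\<^sup>2)"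
    by (simp add: power2_eq_square algebra_simps)
  also have "\<dots> = 2"
    by (simp flip: of_real_power of_real_add)
  finally have prod: "(1 - \<i> * of_real (tan (\<theta> / 2))) * (1 + exp (\<i> * of_real \<theta>)) = 2" .
  then have "1 + exp (\<i> * complex_of_real \<theta>) \<noteq> 0"
    by auto
  with prod have tan_eq: "1 - \<i> * of_real (tan (\<theta> / 2)) = 2 / (1 + exp (\<i> * of_real \<theta>))"
    by (simp only: eq_divide_eq) simp
  have half_twice: "1 / w = 2 / w / 2" for w :: complex
    by simp
  show "1 / (1 + exp (\<i> * of_real \<theta>)) = (1 - \<i> * of_real (tan (\<theta> / 2))) / 2"
    unfolding tan_eq by (rule half_twice)
qed

text \<open>The two series are the even and odd parts on the imaginary axis of the extension for the
  squared harmonic numbers; splitting D in the same way makes E its odd part.\<close>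

lemma harmonic_eta_generating_functions:
  assumes \<theta>: "\<bar>\<theta>\<bar> < 1"
  shows "summable (E_term \<theta>)"
    and "(\<lambda>n. (-1) ^ n * of_real \<theta> ^ (2 * n) / fact (2 * n) * harmonic_eta 2 (- 2 * of_nat n))
      sums (1 / 2 * of_real (pi\<^sup>2 / 12 - (ln (2 * cos (\<theta> / 2)))\<^sup>2)
            - 1 / 2 * of_real (tan (\<theta> / 2)) * (of_real (\<theta> * ln (2 * cos (\<theta> / 2))) - E_fun \<theta>))"
    and "(\<lambda>n. (-1) ^ n * of_real \<theta> ^ (2 * n + 1) / fact (2 * n + 1) * harmonic_eta 2 (- 2 * of_nat n - 1))
      sums (1 / 2 * of_real (tan (\<theta> / 2)) * of_real ((ln (2 * cos (\<theta> / 2)))\<^sup>2 - pi\<^sup>2 / 12)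
            - 1 / 2 * (of_real (\<theta> * ln (2 * cos (\<theta> / 2))) - E_fun \<theta>))"
proof -
  obtain D where D: "extends (\<lambda>_. 1) 2 D"
    and deriv: "\<And>x. x \<in> ball 0 1 \<Longrightarrow> (D has_field_derivative - Ln (1 + exp (- x))) (at x)"
    by (rule extends_primitive[of "\<lambda>_. 1" 2 "\<lambda>x. Ln (1 + exp (- x))"])
      (use slow_one extends_one_1 in auto)
  let ?\<Phi> = "\<lambda>x. (D x - Ln (1 + exp (- x)) ^ 2) * (1 / (1 + exp (- x)))"
  have ext: "extends (\<lambda>n. harm n ^ 2) 0 ?\<Phi>"
  proof (rule extends_harm_power2)
    show "(\<lambda>x. D x - Ln (1 + exp (- x)) ^ 2) holomorphic_on ball 0 1"
      using D by (auto simp: extends_def intro!: holomorphic_intros one_plus_exp_notin_nonpos)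
  qed (use D in \<open>auto simp: extends_def eval_alt_fps_harm_1\<close>)
  \<comment> \<open>By \<open>extends_sums_odd\<close> at s = 2 this is the sum of the series with
    values \<eta>(2 - 2n - 1) = \<eta>(1 - 2n), that is, \<open>E_fun \<theta>\<close>.\<close>
  define E where "E = (D (- \<i> * of_real \<theta>) - D (\<i> * of_real \<theta>)) / (2 * \<i>)"
  have E_term: "E_term \<theta> = (\<lambda>n. (-1) ^ n * of_real \<theta> ^ (2 * n + 1) / fact (2 * n + 1) *
      alt_dirichlet (\<lambda>_. 1) (2 - 2 * of_nat n - 1))"
    by (simp add: fun_eq_iff E_term_def dirichlet_eta_def algebra_simps del: fact_Suc)
  have "E_term \<theta> sums E"
    unfolding E_def E_term by (rule extends_sums_odd[OF slow_one D \<theta>])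
  then show "summable (E_term \<theta>)"
    by (rule sums_summable)
  have E_fun: "E_fun \<theta> = E"
    using \<open>E_term \<theta> sums E\<close> by (simp add: E_fun_def sums_iff)
  define l where "l = complex_of_real (ln (2 * cos (\<theta> / 2)))"
  define t where "t = complex_of_real (tan (\<theta> / 2))"
  \<comment> \<open>The even part of D at \<i>\<theta>. Its term in \<theta>^2 cancels the square of
    \<i>\<theta>/2 coming from the squared logarithm.\<close>
  define e where "e = complex_of_real (pi\<^sup>2 / 12) - of_real \<theta> ^ 2 / 4"
  have "D (\<i> * of_real \<theta>) + D (- (\<i> * of_real \<theta>)) = 2 * e"
    using extends_one_2_even_part[OF D deriv, of "\<i> * of_real \<theta>"] \<theta>
    by (simp add: e_def norm_mult power_mult_distrib)
  then have e: "e = (D (\<i> * of_real \<theta>) + D (- (\<i> * of_real \<theta>))) / 2"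
    by simp
  have iE: "\<i> * E = (D (- (\<i> * of_real \<theta>)) - D (\<i> * of_real \<theta>)) / 2"
    by (simp add: E_def diff_divide_distrib right_diff_distrib)
  have D_values: "D (- \<i> * of_real \<theta>) = e + \<i> * E" "D (\<i> * of_real \<theta>) = e - \<i> * E"
    unfolding e iE by (simp_all add: field_simps)
  have plus: "Ln (1 + exp (- (- \<i> * of_real \<theta>))) = l + \<i> * of_real \<theta> / 2"
    "1 / (1 + exp (- (- \<i> * of_real \<theta>))) = (1 - \<i> * t) / 2"
    using one_plus_exp_imaginary[OF \<theta>] by (simp_all add: l_def t_def)
  have minus: "Ln (1 + exp (- (\<i> * of_real \<theta>))) = l - \<i> * of_real \<theta> / 2"
    "1 / (1 + exp (- (\<i> * of_real \<theta>))) = (1 + \<i> * t) / 2"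
    using one_plus_exp_imaginary[of "- \<theta>"] \<theta> by (simp_all add: l_def t_def)
  have \<Phi>_values: "?\<Phi> (- \<i> * of_real \<theta>) = (e + \<i> * E - (l + \<i> * of_real \<theta> / 2)\<^sup>2) * ((1 - \<i> * t) / 2)"
    "?\<Phi> (\<i> * of_real \<theta>) = (e - \<i> * E - (l - \<i> * of_real \<theta> / 2)\<^sup>2) * ((1 + \<i> * t) / 2)"
    by (simp_all only: D_values plus minus)
  have "(\<lambda>n. (-1) ^ n * of_real \<theta> ^ (2 * n) / fact (2 * n) * harmonic_eta 2 (- 2 * of_nat n))
      sums ((?\<Phi> (- \<i> * of_real \<theta>) + ?\<Phi> (\<i> * of_real \<theta>)) / 2)"
    using extends_sums_even[OF slow_power[OF slow_harm] ext \<theta>] by (simp add: harmonic_eta_def)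
  also have "(?\<Phi> (- \<i> * of_real \<theta>) + ?\<Phi> (\<i> * of_real \<theta>)) / 2 =
      1 / 2 * of_real (pi\<^sup>2 / 12 - (ln (2 * cos (\<theta> / 2)))\<^sup>2)
      - 1 / 2 * of_real (tan (\<theta> / 2)) * (of_real (\<theta> * ln (2 * cos (\<theta> / 2))) - E_fun \<theta>)"
    unfolding \<Phi>_values E_fun of_real_diff of_real_mult[of \<theta>] of_real_power l_def[symmetric] t_def[symmetric] e_def
    by (simp add: field_simps power2_eq_square)
  finally show "(\<lambda>n. (-1) ^ n * of_real \<theta> ^ (2 * n) / fact (2 * n) * harmonic_eta 2 (- 2 * of_nat n))
      sums (1 / 2 * of_real (pi\<^sup>2 / 12 - (ln (2 * cos (\<theta> / 2)))\<^sup>2)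
            - 1 / 2 * of_real (tan (\<theta> / 2)) * (of_real (\<theta> * ln (2 * cos (\<theta> / 2))) - E_fun \<theta>))" .
  have "(\<lambda>n. (-1) ^ n * of_real \<theta> ^ (2 * n + 1) / fact (2 * n + 1) * harmonic_eta 2 (- 2 * of_nat n - 1))
      sums ((?\<Phi> (- \<i> * of_real \<theta>) - ?\<Phi> (\<i> * of_real \<theta>)) / (2 * \<i>))"
    using extends_sums_odd[OF slow_power[OF slow_harm] ext \<theta>] by (simp add: harmonic_eta_def del: fact_Suc)
  also have "(?\<Phi> (- \<i> * of_real \<theta>) - ?\<Phi> (\<i> * of_real \<theta>)) / (2 * \<i>) =
      1 / 2 * of_real (tan (\<theta> / 2)) * of_real ((ln (2 * cos (\<theta> / 2)))\<^sup>2 - pi\<^sup>2 / 12)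
      - 1 / 2 * (of_real (\<theta> * ln (2 * cos (\<theta> / 2))) - E_fun \<theta>)"
    unfolding \<Phi>_values E_fun of_real_diff of_real_mult[of \<theta>] of_real_power l_def[symmetric] t_def[symmetric] e_def
    by (simp add: field_simps power2_eq_square)
  finally show "(\<lambda>n. (-1) ^ n * of_real \<theta> ^ (2 * n + 1) / fact (2 * n + 1) * harmonic_eta 2 (- 2 * of_nat n - 1))
      sums (1 / 2 * of_real (tan (\<theta> / 2)) * of_real ((ln (2 * cos (\<theta> / 2)))\<^sup>2 - pi\<^sup>2 / 12)
            - 1 / 2 * (of_real (\<theta> * ln (2 * cos (\<theta> / 2))) - E_fun \<theta>))" .
qed

theorem theorem8:
  shows "(\<forall>\<^sub>F \<theta> :: real in nhds 0.
            summable (E_term \<theta>) \<and>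
            (\<lambda>n. (-1) ^ n * of_real \<theta> ^ (2 * n) / fact (2 * n)
                    * harmonic_eta 2 (- 2 * of_nat n))
              sums (1 / 2 * of_real (pi\<^sup>2 / 12 - (ln (2 * cos (\<theta> / 2)))\<^sup>2)
                    - 1 / 2 * of_real (tan (\<theta> / 2))
                      * (of_real (\<theta> * ln (2 * cos (\<theta> / 2))) - E_fun \<theta>)) \<and>
            (\<lambda>n. (-1) ^ n * of_real \<theta> ^ (2 * n + 1) / fact (2 * n + 1)
                    * harmonic_eta 2 (- 2 * of_nat n - 1))
              sums (1 / 2 * of_real (tan (\<theta> / 2))
                      * of_real ((ln (2 * cos (\<theta> / 2)))\<^sup>2 - pi\<^sup>2 / 12)
                    - 1 / 2 * (of_real (\<theta> * ln (2 * cos (\<theta> / 2))) - E_fun \<theta>)))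
         \<and>
         (\<forall>k :: nat.
            harmonic_eta 2 (- of_nat k) =
              harmonic_eta 1 (1 - of_nat k) - dirichlet_eta (2 - of_nat k) / 2
              + (\<Sum>j<k. of_nat (k choose j) * dirichlet_eta (of_nat j - of_nat k)
                   * (dirichlet_eta (2 - of_nat j) - 2 * harmonic_eta 1 (1 - of_nat j))))"
proof (rule conjI)
  have "\<forall>\<^sub>F \<theta> :: real in nhds 0. \<theta> \<in> {-1<..<1}"
    by (intro eventually_nhds_in_open) auto
  then have small: "\<forall>\<^sub>F \<theta> :: real in nhds 0. \<bar>\<theta>\<bar> < 1"
    by eventually_elim auto
  show "\<forall>\<^sub>F \<theta> :: real in nhds 0.
            summable (E_term \<theta>) \<and>
            (\<lambda>n. (-1) ^ n * of_real \<theta> ^ (2 * n) / fact (2 * n)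
                    * harmonic_eta 2 (- 2 * of_nat n))
              sums (1 / 2 * of_real (pi\<^sup>2 / 12 - (ln (2 * cos (\<theta> / 2)))\<^sup>2)
                    - 1 / 2 * of_real (tan (\<theta> / 2))
                      * (of_real (\<theta> * ln (2 * cos (\<theta> / 2))) - E_fun \<theta>)) \<and>
            (\<lambda>n. (-1) ^ n * of_real \<theta> ^ (2 * n + 1) / fact (2 * n + 1)
                    * harmonic_eta 2 (- 2 * of_nat n - 1))
              sums (1 / 2 * of_real (tan (\<theta> / 2))
                      * of_real ((ln (2 * cos (\<theta> / 2)))\<^sup>2 - pi\<^sup>2 / 12)
                    - 1 / 2 * (of_real (\<theta> * ln (2 * cos (\<theta> / 2))) - E_fun \<theta>))"
    using small by (rule eventually_mono) (intro conjI harmonic_eta_generating_functions)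
qed (intro allI harmonic_eta_neg)

end
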